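(* Let $R\subset S$ be a ring extension which has FCP, and let $\overline R$ be the integral closure of $R$ in $S$. Then $R\subset S$ is distributive if and only if $R\subseteq \overline R$ is distributive.
   Context: All rings are commutative with unit. A ring extension $R\subseteq S$ means that $R$ is a subring of $S$ with the same unit. $[R,S]$ denotes the set of all $R$-subalgebras of $S$ (i.e. subrings $T$ with $R\subseteq T\subseteq S$), ordered by inclusion; it is a lattice in which the infimum of $T,U$ is $T\cap U$ and the supremum is the compositum $TU$ (the subring generated by $T\cup U$). The extension $R\subseteq S$ is called distributive if the lattice $[R,S]$ is distributive, i.e. $T\cap(UV)=(T\cap U)(T\cap V)$ for all $T,U,V\in[R,S]$. The extension $R\subseteq S$ has FCP if every chain in the poset $[R,S]$ is finite. *)

theory Defs
  imports "HOL-Algebra.Generated_Rings" "HOL-Algebra.Polynomials"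
begin

text \<open>
  A ring extension is given by a ring \<open>S\<close> and a subring \<open>R\<close> of \<open>S\<close>, represented by its
  underlying set (\<open>subring R S\<close>). An intermediate subring \<open>T\<close> is regarded as a ring in its
  own right through the record update \<open>S\<lparr>carrier := T\<rparr>\<close>.
\<close>

definition intermediate_rings :: "'a set \<Rightarrow> ('a, 'b) ring_scheme \<Rightarrow> 'a set set" where
  "intermediate_rings R S = {T. subring T S \<and> R \<subseteq> T}"

definition compositum :: "('a, 'b) ring_scheme \<Rightarrow> 'a set \<Rightarrow> 'a set \<Rightarrow> 'a set" where
  "compositum S T U = generate_ring S (T \<union> U)"

definition distributive_extension :: "'a set \<Rightarrow> ('a, 'b) ring_scheme \<Rightarrow> bool" where
  "distributive_extension R S \<longleftrightarrow>
     (\<forall>T \<in> intermediate_rings R S. \<forall>U \<in> intermediate_rings R S. \<forall>V \<in> intermediate_rings R S.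
        T \<inter> compositum S U V = compositum S (T \<inter> U) (T \<inter> V))"

definition FCP :: "'a set \<Rightarrow> ('a, 'b) ring_scheme \<Rightarrow> bool" where
  "FCP R S \<longleftrightarrow> (\<forall>C \<in> chains (intermediate_rings R S). finite C)"

text \<open>
  Coefficient lists start with the leading coefficient, so \<open>\<one>\<^bsub>S\<^esub> # p\<close> with \<open>set p \<subseteq> R\<close>
  is an arbitrary monic polynomial over \<open>R\<close>.
\<close>

definition integral_closure :: "'a set \<Rightarrow> ('a, 'b) ring_scheme \<Rightarrow> 'a set" where
  "integral_closure R S =
     {x \<in> carrier S. \<exists>p. set p \<subseteq> R \<and> ring.eval S (\<one>\<^bsub>S\<^esub> # p) x = \<zero>\<^bsub>S\<^esub>}"

end

theory Submission
  imports Defs "HOL-Algebra.Finite_Extensions"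
begin

text \<open>
  Write \<open>K\<close> for the base ring and \<open>Kbar\<close> for its integral closure. Only one direction has content:
  distributivity below \<open>Kbar\<close> has to give distributivity everywhere. The proof shows that \<open>Kbar\<close> is a
  neutral element of the lattice of intermediate rings: the map that sends \<open>T\<close> to the pair of its meet and
  its join with \<open>Kbar\<close> respects meets and joins (\<open>meet_Kbar_join\<close>, \<open>join_Kbar_meet\<close>) and is injective
  (\<open>eq_if_same_meet_join_Kbar\<close>). So the lattice embeds into the product of the part below \<open>Kbar\<close>, which
  is distributive by hypothesis, and the part above \<open>Kbar\<close>, which is always distributive
  (\<open>distributive_above_Kbar\<close>) because it consists of the intermediate rings of a Pruefer extension.

  FCP enters through chain conditions only. The ascending one makes \<open>Kbar\<close> finite over \<open>K\<close>. The descending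
  one, for chains \<open>A + z\<^sup>k B\<close>, shows that integrally closed parts are Pruefer: \<open>A + A t\<close> is invertible for
  every \<open>t\<close> (\<open>pruefer\<close>).

  The heart is \<open>comaximal_conductor\<close>. For an intermediate ring \<open>T\<close> and \<open>A = T \<inter> Kbar\<close>, the extension from \<open>A\<close> to
  \<open>Kbar\<close> is integral and the extension from \<open>A\<close> to \<open>T\<close> is Pruefer, and FCP forces the two to
  be nontrivial at different maximal ideals of \<open>A\<close>. This is expressed without localization, by
  an element \<open>e\<close> of \<open>A\<close> with \<open>e Kbar \<subseteq> A\<close> and \<open>(1 - e) t \<in> A\<close>. All lattice properties of \<open>Kbar\<close> follow by
  splitting elements with \<open>e\<close> and \<open>1 - e\<close>; in particular, joins with \<open>Kbar\<close> are plain sums.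
\<close>

context cring
begin

section \<open>Linear combinations and elimination\<close>

lemma subring_carrier: "subring A R \<Longrightarrow> x \<in> A \<Longrightarrow> x \<in> carrier R"
  using subringE(1) by blast

lemma subring_minus:
  assumes "subring A R" and "x \<in> A" and "y \<in> A"
  shows "x \<ominus> y \<in> A"
  using subringE(5,7)[OF assms(1)] assms(2,3) by (simp add: a_minus_def)

lemma subring_pow:
  assumes "subring A R" and "x \<in> A"
  shows "x [^] (n::nat) \<in> A"
  using subringE(3,6)[OF assms(1)] assms(2) by (induct n) auto

lemmas subring_closed = subringE(2,3,5-7) subring_minus subring_pow

text \<open>
  The combinations of a list with coefficients from \<open>Q\<close>, up to an offset in \<open>M\<close>. The
  coefficients form an arbitrary set because elimination uses values of polynomials of bounded
  degree as well as ideals; the offset allows combinations modulo a submodule.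
\<close>
fun lin_comb :: "'a set \<Rightarrow> 'a set \<Rightarrow> 'a list \<Rightarrow> 'a set" where
  "lin_comb M Q [] = M"
| "lin_comb M Q (g # gs) = {q \<otimes> g \<oplus> y |q y. q \<in> Q \<and> y \<in> lin_comb M Q gs}"

lemma lin_comb_carrier:
  assumes "M \<subseteq> carrier R" "Q \<subseteq> carrier R" "set gs \<subseteq> carrier R"
  shows "lin_comb M Q gs \<subseteq> carrier R"
  using assms(3)
proof (induct gs)
  case (Cons g gs)
  then have "g \<in> carrier R" "lin_comb M Q gs \<subseteq> carrier R" by auto
  then show ?case using assms(2) by (auto intro!: a_closed m_closed)
qed (use assms(1) in simp)

lemma lin_comb_mono:
  assumes "M \<subseteq> M'" "Q \<subseteq> Q'"
  shows "lin_comb M Q gs \<subseteq> lin_comb M' Q' gs"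
proof (induct gs)
  case (Cons g gs)
  then show ?case using assms(2) by (simp, blast)
qed (use assms(1) in simp)

lemma lin_comb_base:
  assumes "M \<subseteq> carrier R" "\<zero> \<in> Q" "set gs \<subseteq> carrier R"
  shows "M \<subseteq> lin_comb M Q gs"
  using assms(3)
proof (induct gs)
  case (Cons g gs)
  show ?case
  proof
    fix m assume m: "m \<in> M"
    have "m = \<zero> \<otimes> g \<oplus> m" using m assms Cons(2) by auto
    moreover have "m \<in> lin_comb M Q gs" using m Cons by auto
    ultimately show "m \<in> lin_comb M Q (g # gs)" using assms(2) by auto
  qed
qed simp

lemma lin_comb_add:
  assumes c: "M \<subseteq> carrier R" "Q \<subseteq> carrier R"
    and M: "\<And>x y. x \<in> M \<Longrightarrow> y \<in> M \<Longrightarrow> x \<oplus> y \<in> M"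
    and Q: "\<And>x y. x \<in> Q \<Longrightarrow> y \<in> Q \<Longrightarrow> x \<oplus> y \<in> Q"
  shows "set gs \<subseteq> carrier R \<Longrightarrow> x \<in> lin_comb M Q gs \<Longrightarrow> y \<in> lin_comb M Q gs \<Longrightarrow> x \<oplus> y \<in> lin_comb M Q gs"
proof (induct gs arbitrary: x y)
  case Nil
  then show ?case using M by auto
next
  case (Cons g gs)
  obtain q u where x: "x = q \<otimes> g \<oplus> u" "q \<in> Q" "u \<in> lin_comb M Q gs" using Cons(3) by auto
  obtain r v where y: "y = r \<otimes> g \<oplus> v" "r \<in> Q" "v \<in> lin_comb M Q gs" using Cons(4) by auto
  have "q \<in> carrier R" "r \<in> carrier R" "u \<in> carrier R" "v \<in> carrier R" "g \<in> carrier R"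
    using x y c Cons(2) lin_comb_carrier[OF c, of gs] by auto
  then have "x \<oplus> y = (q \<oplus> r) \<otimes> g \<oplus> (u \<oplus> v)" unfolding x y by algebra
  moreover have "u \<oplus> v \<in> lin_comb M Q gs" using Cons x y by auto
  ultimately show ?case using Q x(2) y(2) by auto
qed

lemma lin_comb_scale:
  assumes c: "M \<subseteq> carrier R" "Q \<subseteq> carrier R" "r \<in> carrier R"
    and M: "\<And>x. x \<in> M \<Longrightarrow> r \<otimes> x \<in> M'"
    and Q: "\<And>x. x \<in> Q \<Longrightarrow> r \<otimes> x \<in> Q'"
  shows "set gs \<subseteq> carrier R \<Longrightarrow> x \<in> lin_comb M Q gs \<Longrightarrow> r \<otimes> x \<in> lin_comb M' Q' gs"
proof (induct gs arbitrary: x)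
  case Nil
  then show ?case using M by auto
next
  case (Cons g gs)
  obtain q u where x: "x = q \<otimes> g \<oplus> u" "q \<in> Q" "u \<in> lin_comb M Q gs" using Cons(3) by auto
  have "q \<in> carrier R" "u \<in> carrier R" "g \<in> carrier R"
    using x c Cons(2) lin_comb_carrier[OF c(1,2), of gs] by auto
  then have "r \<otimes> x = (r \<otimes> q) \<otimes> g \<oplus> r \<otimes> u" unfolding x using c(3) by algebra
  then show ?case using Q x Cons by auto
qed

lemma lin_comb_into:
  assumes c: "M \<subseteq> carrier R" "Q \<subseteq> carrier R" "r \<in> carrier R"
    and N: "\<And>x y. x \<in> N \<Longrightarrow> y \<in> N \<Longrightarrow> x \<oplus> y \<in> N"
    and M: "\<And>x. x \<in> M \<Longrightarrow> r \<otimes> x \<in> N"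
    and Q: "\<And>q x. q \<in> Q \<Longrightarrow> x \<in> N \<Longrightarrow> q \<otimes> x \<in> N"
  shows "set gs \<subseteq> carrier R \<Longrightarrow> (\<And>g. g \<in> set gs \<Longrightarrow> r \<otimes> g \<in> N) \<Longrightarrow> x \<in> lin_comb M Q gs \<Longrightarrow> r \<otimes> x \<in> N"
proof (induct gs arbitrary: x)
  case Nil
  then show ?case using M by auto
next
  case (Cons g gs)
  obtain q u where x: "x = q \<otimes> g \<oplus> u" "q \<in> Q" "u \<in> lin_comb M Q gs" using Cons(4) by auto
  have "q \<in> carrier R" "u \<in> carrier R" "g \<in> carrier R"
    using x c Cons(2) lin_comb_carrier[OF c(1,2), of gs] by auto
  then have "r \<otimes> x = q \<otimes> (r \<otimes> g) \<oplus> r \<otimes> u" unfolding x using c(3) by algebra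
  then show ?case using Q N x Cons by auto
qed

lemma lin_comb_append:
  assumes c: "Q \<subseteq> carrier R"
  shows "set gs \<subseteq> carrier R \<Longrightarrow> set hs \<subseteq> carrier R \<Longrightarrow>
    x \<in> lin_comb {\<zero>} Q gs \<Longrightarrow> y \<in> lin_comb {\<zero>} Q hs \<Longrightarrow> x \<oplus> y \<in> lin_comb {\<zero>} Q (gs @ hs)"
proof (induct gs arbitrary: x)
  case Nil
  then show ?case using lin_comb_carrier[OF _ c, of "{\<zero>}" hs] by auto
next
  case (Cons g gs)
  obtain q u where x: "x = q \<otimes> g \<oplus> u" "q \<in> Q" "u \<in> lin_comb {\<zero>} Q gs" using Cons(4) by auto
  have "q \<in> carrier R" "u \<in> carrier R" "g \<in> carrier R" "y \<in> carrier R"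
    using x c Cons lin_comb_carrier[OF _ c(1), of "{\<zero>}" gs] lin_comb_carrier[OF _ c(1), of "{\<zero>}" hs] by auto
  then have "x \<oplus> y = q \<otimes> g \<oplus> (u \<oplus> y)" unfolding x by algebra
  then show ?case using x Cons by auto
qed

lemma lin_comb_map_mult:
  assumes c: "Q \<subseteq> carrier R" "h \<in> carrier R"
  shows "set gs \<subseteq> carrier R \<Longrightarrow> x \<in> lin_comb {\<zero>} Q gs \<Longrightarrow> x \<otimes> h \<in> lin_comb {\<zero>} Q (map (\<lambda>g. g \<otimes> h) gs)"
proof (induct gs arbitrary: x)
  case Nil
  then show ?case using c by auto
next
  case (Cons g gs)
  obtain q u where x: "x = q \<otimes> g \<oplus> u" "q \<in> Q" "u \<in> lin_comb {\<zero>} Q gs" using Cons(3) by auto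
  have "q \<in> carrier R" "u \<in> carrier R" "g \<in> carrier R"
    using x c Cons(2) lin_comb_carrier[OF _ c(1), of "{\<zero>}" gs] by auto
  then have "x \<otimes> h = q \<otimes> (g \<otimes> h) \<oplus> u \<otimes> h" unfolding x using c(2) by algebra
  then show ?case using x Cons by auto
qed

text \<open>
  Gaussian elimination without division. Each row says \<open>p \<otimes> g = (combination of all generators)\<close> modulo
  \<open>M\<close>, with a pivot \<open>p\<close> from \<open>P n\<close> that dominates the coefficients from \<open>Q n\<close>. Moving the diagonal
  coefficient to the left turns the first row into \<open>p0 \<otimes> g = (combination of the others)\<close>; multiplying the
  other rows by \<open>p0\<close> then removes \<open>g\<close> from them, and the closure conditions keep pivots pivots. In the
  end a single pivot multiplies all generators into \<open>M\<close>.
  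
  The lemma is used twice. With monic polynomials of degree \<open>n\<close> as pivots and polynomials of degree below \<open>n\<close>
  as coefficients it shows that elements of a finite extension are integral; with \<open>1 + J\<close> and an
  ideal \<open>J\<close> it is the Nakayama lemma. It replaces the determinant trick in both.
\<close>
lemma elimination:
  assumes M: "M \<subseteq> carrier R" "\<And>x y. x \<in> M \<Longrightarrow> y \<in> M \<Longrightarrow> x \<oplus> y \<in> M"
    and c: "\<And>n. P n \<subseteq> carrier R" "\<And>n. Q n \<subseteq> carrier R"
    and PM: "\<And>n p x. p \<in> P n \<Longrightarrow> x \<in> M \<Longrightarrow> p \<otimes> x \<in> M"
    and QM: "\<And>n q x. q \<in> Q n \<Longrightarrow> x \<in> M \<Longrightarrow> q \<otimes> x \<in> M"
    and one: "\<one> \<in> P (0::nat)"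
    and QQa: "\<And>n q r. q \<in> Q n \<Longrightarrow> r \<in> Q n \<Longrightarrow> q \<oplus> r \<in> Q n"
    and PQd: "\<And>n p q. p \<in> P n \<Longrightarrow> q \<in> Q n \<Longrightarrow> p \<ominus> q \<in> P n"
    and PP: "\<And>m n p q. p \<in> P m \<Longrightarrow> q \<in> P n \<Longrightarrow> p \<otimes> q \<in> P (m + n)"
    and PQ: "\<And>m n p q. p \<in> P m \<Longrightarrow> q \<in> Q n \<Longrightarrow> p \<otimes> q \<in> Q (m + n)"
    and QQ: "\<And>m n p q. p \<in> Q m \<Longrightarrow> q \<in> Q n \<Longrightarrow> p \<otimes> q \<in> Q (m + n)"
  shows "set gs \<subseteq> carrier R \<Longrightarrow> (\<And>g. g \<in> set gs \<Longrightarrow> \<exists>n. \<exists>p\<in>P n. p \<otimes> g \<in> lin_comb M (Q n) gs) \<Longrightarrow>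
    \<exists>n. \<exists>p\<in>P n. \<forall>g\<in>set gs. p \<otimes> g \<in> M"
proof (induct gs)
  case Nil
  then show ?case using one by auto
next
  case (Cons g gs)
  have gc: "g \<in> carrier R" and gsc: "set gs \<subseteq> carrier R" using Cons(2) by auto
  obtain n p q y where p: "p \<in> P n" "p \<otimes> g = q \<otimes> g \<oplus> y" "q \<in> Q n" "y \<in> lin_comb M (Q n) gs"
    using Cons(3)[of g] by auto
  define p0 where "p0 = p \<ominus> q"
  have p0: "p0 \<in> P n" unfolding p0_def using p PQd by auto
  have cc: "p \<in> carrier R" "q \<in> carrier R" "y \<in> carrier R" "p0 \<in> carrier R"
    using p p0 c lin_comb_carrier[OF M(1) c(2) gsc] by blast+
  have "p0 \<otimes> g = p \<otimes> g \<ominus> q \<otimes> g" unfolding p0_def using cc gc by algebra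
  also have "\<dots> = y" unfolding p(2) using cc gc by algebra
  finally have p0g: "p0 \<otimes> g = y" .
  have "\<exists>k. \<exists>p\<in>P k. p \<otimes> h \<in> lin_comb M (Q k) gs" if h: "h \<in> set gs" for h
  proof -
    obtain m p' q' y' where p': "p' \<in> P m" "p' \<otimes> h = q' \<otimes> g \<oplus> y'" "q' \<in> Q m" "y' \<in> lin_comb M (Q m) gs"
      using Cons(3)[of h] h by auto
    have cc': "p' \<in> carrier R" "q' \<in> carrier R" "y' \<in> carrier R" "h \<in> carrier R"
      using p' c lin_comb_carrier[OF M(1) c(2) gsc] h gsc by blast+
    have "(p0 \<otimes> p') \<otimes> h = p0 \<otimes> (p' \<otimes> h)" using cc cc' by algebra
    also have "\<dots> = q' \<otimes> (p0 \<otimes> g) \<oplus> p0 \<otimes> y'" unfolding p'(2) using cc cc' gc by algebra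
    finally have e: "(p0 \<otimes> p') \<otimes> h = q' \<otimes> y \<oplus> p0 \<otimes> y'" unfolding p0g .
    have "q' \<otimes> y \<in> lin_comb M (Q (m + n)) gs"
      by (rule lin_comb_scale[OF M(1) c(2) cc'(2) _ _ gsc p(4)]) (use p' QM QQ in auto)
    then have "q' \<otimes> y \<in> lin_comb M (Q (n + m)) gs" by (simp add: add.commute)
    moreover have "p0 \<otimes> y' \<in> lin_comb M (Q (n + m)) gs"
      by (rule lin_comb_scale[OF M(1) c(2) cc(4) _ _ gsc p'(4)]) (use p0 PM PQ in auto)
    ultimately have "(p0 \<otimes> p') \<otimes> h \<in> lin_comb M (Q (n + m)) gs"
      unfolding e using lin_comb_add[OF M(1) c(2) M(2) QQa gsc] by blast
    then show ?thesis using PP p0 p'(1) by blast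
  qed
  then obtain k r where r: "r \<in> P k" "\<And>h. h \<in> set gs \<Longrightarrow> r \<otimes> h \<in> M"
    using Cons(1)[OF gsc] by blast
  have rc: "r \<in> carrier R" using r c by blast
  have "r \<otimes> y \<in> M"
    by (rule lin_comb_into[OF M(1) c(2)[of n] rc M(2) _ _ gsc _ p(4)]) (use r PM QM in auto)
  moreover have "(r \<otimes> p0) \<otimes> g = r \<otimes> y" using cc rc gc by (simp add: p0g[symmetric] m_assoc)
  moreover have "(r \<otimes> p0) \<otimes> h \<in> M" if "h \<in> set gs" for h
  proof -
    have "(r \<otimes> p0) \<otimes> h = p0 \<otimes> (r \<otimes> h)" using cc rc gsc that by (simp add: m_ac subset_eq)
    then show ?thesis using PM p0 r that by auto
  qed
  ultimately show ?case using PP[OF r(1) p0] by (intro exI[of _ "k + n"] bexI[of _ "r \<otimes> p0"]) auto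
qed

section \<open>Integral elements and module-finite extensions\<close>

fun pows :: "'a \<Rightarrow> nat \<Rightarrow> 'a list" where
  "pows x 0 = []"
| "pows x (Suc n) = x [^] n # pows x n"

text \<open>
  The values at \<open>x\<close> of the polynomials over \<open>A\<close> of degree below \<open>n\<close>. With them, a monic equation of
  degree \<open>n\<close> for \<open>x\<close> is just the membership \<open>x [^] n \<in> polys A x n\<close>, and no polynomial has to be named.
\<close>
definition polys :: "'a set \<Rightarrow> 'a \<Rightarrow> nat \<Rightarrow> 'a set" where
  "polys A x n = lin_comb {\<zero>} A (pows x n)"

definition integral_over :: "'a set \<Rightarrow> 'a \<Rightarrow> bool" where
  "integral_over A x \<longleftrightarrow> x \<in> carrier R \<and> (\<exists>n. x [^] n \<in> polys A x n)"

definition module_finite :: "'a set \<Rightarrow> 'a set \<Rightarrow> bool" where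
  "module_finite A B \<longleftrightarrow> (\<exists>gs. set gs \<subseteq> B \<and> B \<subseteq> lin_comb {\<zero>} A gs)"

lemma pows_carrier: "x \<in> carrier R \<Longrightarrow> set (pows x n) \<subseteq> carrier R"
  by (induct n) auto

lemma polys_0 [simp]: "polys A x 0 = {\<zero>}"
  by (simp add: polys_def)

lemma polys_Suc: "polys A x (Suc n) = {a \<otimes> x [^] n \<oplus> y |a y. a \<in> A \<and> y \<in> polys A x n}"
  by (simp add: polys_def)

lemma polys_SucI: "a \<in> A \<Longrightarrow> y \<in> polys A x n \<Longrightarrow> a \<otimes> x [^] n \<oplus> y \<in> polys A x (Suc n)"
  by (auto simp: polys_Suc)

lemma polys_mono_coeffs: "A \<subseteq> B \<Longrightarrow> polys A x n \<subseteq> polys B x n"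
  unfolding polys_def by (rule lin_comb_mono) auto

context
  fixes A x
  assumes A: "subring A R" and x: "x \<in> carrier R"
begin

lemma polys_carrier: "y \<in> polys A x n \<Longrightarrow> y \<in> carrier R"
  using lin_comb_carrier[of "{\<zero>}" A "pows x n"] subringE(1)[OF A] pows_carrier[OF x]
  unfolding polys_def by blast

lemma polys_add: "y \<in> polys A x n \<Longrightarrow> z \<in> polys A x n \<Longrightarrow> y \<oplus> z \<in> polys A x n"
  using lin_comb_add[of "{\<zero>}" A "pows x n" y z] subringE(1,7)[OF A] pows_carrier[OF x]
  unfolding polys_def by auto

lemma polys_scale: "a \<in> A \<Longrightarrow> y \<in> polys A x n \<Longrightarrow> a \<otimes> y \<in> polys A x n"
  using lin_comb_scale[of "{\<zero>}" A a "{\<zero>}" A "pows x n" y] subringE(1,6)[OF A] pows_carrier[OF x]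
  unfolding polys_def by auto

lemma polys_neg: "y \<in> polys A x n \<Longrightarrow> \<ominus> y \<in> polys A x n"
  using polys_scale[of "\<ominus> \<one>" y n] polys_carrier[of y n] subringE(3,5)[OF A] by (simp add: l_minus)

lemma polys_minus: "y \<in> polys A x n \<Longrightarrow> z \<in> polys A x n \<Longrightarrow> y \<ominus> z \<in> polys A x n"
  using polys_add polys_neg by (simp add: a_minus_def)

lemma polys_Suc_mono: "y \<in> polys A x n \<Longrightarrow> y \<in> polys A x (Suc n)"
  using polys_SucI[of "\<zero>" A y x n] polys_carrier[of y n] x subringE(2)[OF A] by simp

lemma polys_mono:
  assumes "n \<le> m" and "y \<in> polys A x n"
  shows "y \<in> polys A x m"
  using assms by (induct m rule: dec_induct) (auto intro: polys_Suc_mono)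

lemma polys_zero: "\<zero> \<in> polys A x n"
  using polys_mono[of 0 n \<zero>] by simp

lemma polys_const:
  assumes "a \<in> A"
  shows "a \<in> polys A x (Suc n)"
proof -
  have "a \<in> polys A x (Suc 0)"
    using polys_SucI[of a A \<zero> x 0] assms subring_carrier[OF A assms] by simp
  then show ?thesis by (rule polys_mono[rotated]) simp
qed

lemma polys_pow_mult: "y \<in> polys A x n \<Longrightarrow> x [^] k \<otimes> y \<in> polys A x (k + n)"
proof (induct n arbitrary: y)
  case 0
  then show ?case using polys_zero x by simp
next
  case (Suc n)
  then obtain a z where y: "y = a \<otimes> x [^] n \<oplus> z" "a \<in> A" "z \<in> polys A x n" by (auto simp: polys_Suc)
  have c: "a \<in> carrier R" "z \<in> carrier R" "x [^] k \<in> carrier R" "x [^] n \<in> carrier R"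
    using y polys_carrier subring_carrier[OF A] x by auto
  have "x [^] k \<otimes> y = a \<otimes> (x [^] k \<otimes> x [^] n) \<oplus> x [^] k \<otimes> z" unfolding y(1) using c by algebra
  also have "\<dots> = a \<otimes> x [^] (k + n) \<oplus> x [^] k \<otimes> z" using x by (simp add: nat_pow_mult)
  finally show ?case using polys_SucI[OF y(2) Suc(1)[OF y(3)]] by simp
qed

lemma polys_mult: "y \<in> polys A x n \<Longrightarrow> z \<in> polys A x m \<Longrightarrow> y \<otimes> z \<in> polys A x (n + m)"
proof (induct n arbitrary: y)
  case 0
  then show ?case using polys_zero polys_carrier by simp
next
  case (Suc n)
  obtain a w where y: "y = a \<otimes> x [^] n \<oplus> w" "a \<in> A" "w \<in> polys A x n" using Suc(2) by (auto simp: polys_Suc)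
  have c: "a \<in> carrier R" "w \<in> carrier R" "z \<in> carrier R" "x [^] n \<in> carrier R"
    using y Suc(3) polys_carrier subring_carrier[OF A] x by auto
  have "y \<otimes> z = a \<otimes> (x [^] n \<otimes> z) \<oplus> w \<otimes> z" unfolding y(1) using c by algebra
  moreover have "a \<otimes> (x [^] n \<otimes> z) \<oplus> w \<otimes> z \<in> polys A x (n + m)"
    by (intro polys_add polys_scale y polys_pow_mult Suc)
  ultimately show ?case using polys_mono[of "n + m" "Suc n + m"] by simp
qed

lemma eval_polys: "set p \<subseteq> A \<Longrightarrow> eval p x \<in> polys A x (length p)"
  by (induct p) (auto intro: polys_SucI)

lemma polys_eval: "y \<in> polys A x n \<Longrightarrow> \<exists>p. set p \<subseteq> A \<and> length p = n \<and> eval p x = y"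
proof (induct n arbitrary: y)
  case (Suc n)
  then obtain a z where y: "y = a \<otimes> x [^] n \<oplus> z" "a \<in> A" "z \<in> polys A x n" by (auto simp: polys_Suc)
  then obtain p where "set p \<subseteq> A" "length p = n" "eval p x = z" using Suc(1) by blast
  then show ?case using y by (intro exI[of _ "a # p"]) auto
qed auto

text \<open>
  Elements of \<open>simple_extension A x\<close> are built by Horner's scheme, so sums, scalar multiples and
  products are handled by induction on the scheme, in this order.
\<close>
lemma simple_extension_subring: "subring (simple_extension A x) R"
proof -
  note Ac = subring_carrier[OF A] and E = subring_closed[OF A]
  have car: "simple_extension A x \<subseteq> carrier R"
    using simple_extension_in_carrier[OF subringE(1)[OF A] x] .
  have add: "y \<oplus> z \<in> simple_extension A x" if "y \<in> simple_extension A x" "z \<in> simple_extension A x" for y z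
    using that
  proof (induct arbitrary: z rule: simple_extension.induct)
    case zero
    then show ?case using car by auto
  next
    case (lin k1 k2)
    from lin(4) show ?case
    proof (cases rule: simple_extension.cases)
      case zero
      then show ?thesis using lin simple_extension.lin[OF lin(1,3)] car by auto
    next
      case (lin l1 l2)
      have "k1 \<in> carrier R" "k2 \<in> carrier R" "l1 \<in> carrier R" "l2 \<in> carrier R"
        using lin \<open>k1 \<in> simple_extension A x\<close> \<open>k2 \<in> A\<close> car Ac by auto
      then have "k1 \<otimes> x \<oplus> k2 \<oplus> z = (k1 \<oplus> l1) \<otimes> x \<oplus> (k2 \<oplus> l2)"
        unfolding lin(1) using x by algebra
      moreover have "(k1 \<oplus> l1) \<otimes> x \<oplus> (k2 \<oplus> l2) \<in> simple_extension A x"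
        using lin \<open>k2 \<in> A\<close> \<open>\<And>z. z \<in> simple_extension A x \<Longrightarrow> k1 \<oplus> z \<in> simple_extension A x\<close> E
        by (intro simple_extension.lin) auto
      ultimately show ?thesis by simp
    qed
  qed
  have scale: "a \<otimes> y \<in> simple_extension A x" if "y \<in> simple_extension A x" "a \<in> A" for y a
    using that
  proof (induct rule: simple_extension.induct)
    case zero
    then show ?case using Ac by auto
  next
    case (lin k1 k2)
    have "k1 \<in> carrier R" "k2 \<in> carrier R" "a \<in> carrier R" using lin car Ac by auto
    then have "a \<otimes> (k1 \<otimes> x \<oplus> k2) = (a \<otimes> k1) \<otimes> x \<oplus> a \<otimes> k2" using x by algebra
    then show ?case using lin simple_extension.lin E by auto
  qed
  have xmul: "y \<otimes> x \<in> simple_extension A x" if "y \<in> simple_extension A x" for y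
    using simple_extension.lin[OF that E(1)] that car x by auto
  have mult: "y \<otimes> z \<in> simple_extension A x" if "y \<in> simple_extension A x" "z \<in> simple_extension A x" for y z
    using that
  proof (induct rule: simple_extension.induct)
    case zero
    then show ?case using car by auto
  next
    case (lin k1 k2)
    have "k1 \<in> carrier R" "k2 \<in> carrier R" "z \<in> carrier R" using lin car Ac by auto
    then have "(k1 \<otimes> x \<oplus> k2) \<otimes> z = (k1 \<otimes> z) \<otimes> x \<oplus> k2 \<otimes> z" using x by algebra
    then show ?case using lin add xmul scale by auto
  qed
  have one: "\<one> \<in> simple_extension A x"
    using simple_extension_incl[OF subringE(1)[OF A] x] E by auto
  have neg: "\<ominus> y \<in> simple_extension A x" if "y \<in> simple_extension A x" for y
    using scale[OF that E(3)[OF E(2)]] that car by (auto simp: l_minus)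
  show ?thesis
    by (rule subringI) (use car add mult one neg in auto)
qed

end

lemma integral_closure_eq:
  assumes "subring A R"
  shows "integral_closure A R = {x. integral_over A x}"
proof -
  have "(\<exists>p. set p \<subseteq> A \<and> eval (\<one> # p) x = \<zero>) \<longleftrightarrow> (\<exists>n. x [^] n \<in> polys A x n)"
    if x: "x \<in> carrier R" for x
  proof
    assume "\<exists>p. set p \<subseteq> A \<and> eval (\<one> # p) x = \<zero>"
    then obtain p where p: "set p \<subseteq> A" "eval (\<one> # p) x = \<zero>" by blast
    note e = eval_polys[OF assms x p(1)]
    have "x [^] length p \<oplus> eval p x = \<zero>" using p x by simp
    then have "x [^] length p = \<ominus> eval p x"
      using x polys_carrier[OF assms x e] by (simp add: minus_equality)
    then show "\<exists>n. x [^] n \<in> polys A x n" using polys_neg[OF assms x e] by metis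
  next
    assume "\<exists>n. x [^] n \<in> polys A x n"
    then obtain n where n: "x [^] n \<in> polys A x n" by blast
    obtain p where p: "set p \<subseteq> A" "length p = n" "eval p x = \<ominus> (x [^] n)"
      using polys_eval[OF assms x polys_neg[OF assms x n]] by blast
    have "eval (\<one> # p) x = \<zero>" using p x by (simp add: r_neg)
    then show "\<exists>p. set p \<subseteq> A \<and> eval (\<one> # p) x = \<zero>" using p by blast
  qed
  then show ?thesis unfolding integral_closure_def integral_over_def by blast
qed

lemma integral_over_self:
  assumes "subring A R" and "x \<in> A"
  shows "integral_over A x"
  using polys_const[OF assms(1) _ assms(2), of x 0] subring_carrier[OF assms]
  unfolding integral_over_def by (auto intro!: exI[of _ 1])

lemma integral_over_mono: "A \<subseteq> B \<Longrightarrow> integral_over A x \<Longrightarrow> integral_over B x"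
  unfolding integral_over_def using polys_mono_coeffs by blast

lemma module_finite_self:
  assumes "subring A R"
  shows "module_finite A A"
  unfolding module_finite_def
proof (intro exI conjI)
  show "set [\<one>] \<subseteq> A" using subring_closed[OF assms] by simp
  show "A \<subseteq> lin_comb {\<zero>} A [\<one>]" using subring_carrier[OF assms] by force
qed

text \<open>
  Multiplication by \<open>x\<close> expresses each generator \<open>x \<otimes> g\<close> by the generators, which is a system of rows with
  pivot \<open>x\<close>. Elimination yields a monic polynomial whose value at \<open>x\<close> kills all generators, hence kills
  \<open>\<one>\<close>.
\<close>
lemma module_finite_integral:
  assumes A: "subring A R" and B: "subring B R" and AB: "A \<subseteq> B"
    and fin: "module_finite A B" and x: "x \<in> B"
  shows "integral_over A x"
proof -
  have xc: "x \<in> carrier R" using subring_carrier[OF B x] .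
  obtain gs where gs: "set gs \<subseteq> B" "B \<subseteq> lin_comb {\<zero>} A gs" using fin unfolding module_finite_def by blast
  have gsc: "set gs \<subseteq> carrier R" using gs(1) subringE(1)[OF B] by blast
  define Q where "Q = polys A x"
  define P where "P n = {x [^] n \<oplus> q |q. q \<in> Q n}" for n
  have Qc: "Q n \<subseteq> carrier R" for n unfolding Q_def using polys_carrier[OF A xc] by blast
  then have Pc: "P n \<subseteq> carrier R" for n unfolding P_def using xc by blast
  have Pow: "x [^] n \<otimes> q \<in> Q (n + m)" if "q \<in> Q m" for n m q
    using that unfolding Q_def by (rule polys_pow_mult[OF A xc])
  have PQ: "p \<otimes> q \<in> Q (m + n)" if "p \<in> P m" "q \<in> Q n" for m n p q
  proof -
    obtain r where r: "p = x [^] m \<oplus> r" "r \<in> Q m" using \<open>p \<in> P m\<close> unfolding P_def by blast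
    have "q \<in> carrier R" "r \<in> carrier R" "x [^] m \<in> carrier R" using r that Qc xc by blast+
    then have "p \<otimes> q = x [^] m \<otimes> q \<oplus> r \<otimes> q" unfolding r(1) by algebra
    then show ?thesis using Pow[OF that(2), of m] r(2) that(2) polys_add[OF A xc] polys_mult[OF A xc]
      unfolding Q_def by simp
  qed
  have PP: "p \<otimes> q \<in> P (m + n)" if "p \<in> P m" "q \<in> P n" for m n p q
  proof -
    obtain r where r: "q = x [^] n \<oplus> r" "r \<in> Q n" using \<open>q \<in> P n\<close> unfolding P_def by blast
    obtain s where s: "p = x [^] m \<oplus> s" "s \<in> Q m" using \<open>p \<in> P m\<close> unfolding P_def by blast
    have c: "p \<in> carrier R" "s \<in> carrier R" "r \<in> carrier R" "x [^] m \<in> carrier R" "x [^] n \<in> carrier R"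
      using r s that Pc Qc xc by blast+
    have "p \<otimes> q = x [^] n \<otimes> p \<oplus> p \<otimes> r" unfolding r(1) using c by algebra
    also have "\<dots> = x [^] m \<otimes> x [^] n \<oplus> (x [^] n \<otimes> s \<oplus> p \<otimes> r)" unfolding s(1) using c by algebra
    also have "\<dots> = x [^] (m + n) \<oplus> (x [^] n \<otimes> s \<oplus> p \<otimes> r)" using xc by (simp add: nat_pow_mult)
    finally have "p \<otimes> q = x [^] (m + n) \<oplus> (x [^] n \<otimes> s \<oplus> p \<otimes> r)" .
    moreover have "x [^] n \<otimes> s \<oplus> p \<otimes> r \<in> Q (m + n)"
      using Pow[OF s(2), of n] PQ[OF that(1) r(2)] polys_add[OF A xc] unfolding Q_def
      by (simp add: add.commute)
    ultimately show ?thesis unfolding P_def by blast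
  qed
  have PQd: "p \<ominus> q \<in> P n" if "p \<in> P n" "q \<in> Q n" for n p q
  proof -
    obtain r where r: "p = x [^] n \<oplus> r" "r \<in> Q n" using \<open>p \<in> P n\<close> unfolding P_def by blast
    have "q \<in> carrier R" "r \<in> carrier R" "x [^] n \<in> carrier R" using r that Qc xc by blast+
    then have "p \<ominus> q = x [^] n \<oplus> (r \<ominus> q)" unfolding r(1) by algebra
    then show ?thesis using polys_minus[OF A xc] r(2) that(2) unfolding P_def Q_def by blast
  qed
  have rows: "\<exists>n. \<exists>p\<in>P n. p \<otimes> g \<in> lin_comb {\<zero>} (Q n) gs" if "g \<in> set gs" for g
  proof (intro exI bexI)
    have "x \<otimes> g \<in> lin_comb {\<zero>} A gs" using gs x that subring_closed[OF B] by blast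
    moreover have "lin_comb {\<zero>} A gs \<subseteq> lin_comb {\<zero>} (Q (Suc 0)) gs"
      by (rule lin_comb_mono) (use polys_const[OF A xc] in \<open>auto simp: Q_def\<close>)
    ultimately show "x \<otimes> g \<in> lin_comb {\<zero>} (Q (Suc 0)) gs" by blast
    show "x \<in> P (Suc 0)" unfolding P_def Q_def
      using polys_zero[OF A xc, of "Suc 0"] xc by (auto intro!: exI[of _ \<zero>])
  qed
  have "\<exists>n. \<exists>p\<in>P n. \<forall>g\<in>set gs. p \<otimes> g \<in> {\<zero>}"
  proof (rule elimination[where Q = Q, OF _ _ Pc Qc _ _ _ _ PQd PP PQ _ gsc rows])
    show "\<one> \<in> P 0" unfolding P_def Q_def by simp
  next
    fix n q r assume "q \<in> Q n" "r \<in> Q n" then show "q \<oplus> r \<in> Q n"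
      unfolding Q_def by (rule polys_add[OF A xc])
  next
    fix m n p q assume "p \<in> Q m" "q \<in> Q n" then show "p \<otimes> q \<in> Q (m + n)"
      unfolding Q_def by (rule polys_mult[OF A xc])
  qed (use Pc Qc in \<open>auto simp: subset_eq\<close>)
  then obtain n p where p: "p \<in> P n" "\<And>g. g \<in> set gs \<Longrightarrow> p \<otimes> g = \<zero>" by auto
  have pc: "p \<in> carrier R" using p Pc by blast
  have "p \<otimes> \<one> \<in> {\<zero>}"
    by (rule lin_comb_into[where M = "{\<zero>}" and Q = A and gs = gs])
      (use pc p gsc gs subringE(1,3)[OF A] subringE(3)[OF B] in auto)
  then have "p = \<zero>" using pc by simp
  then obtain q where q: "x [^] n \<oplus> q = \<zero>" "q \<in> Q n" using p(1) unfolding P_def by auto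
  then have "x [^] n = \<ominus> q" using minus_equality[of "x [^] n" q] xc Qc[of n] by auto
  then have "x [^] n \<in> polys A x n" using q(2) polys_neg[OF A xc] unfolding Q_def by simp
  then show ?thesis using xc unfolding integral_over_def by blast
qed

lemma integral_simple_extension:
  assumes B: "subring B R" and int: "integral_over B x"
  obtains n where "simple_extension B x \<subseteq> polys B x n"
proof -
  have xc: "x \<in> carrier R" using int unfolding integral_over_def by blast
  obtain n where n: "x [^] n \<in> polys B x n" using int unfolding integral_over_def by blast
  have n': "x [^] Suc n \<in> polys B x (Suc n)"
    using polys_pow_mult[OF B xc n, of 1] xc by (simp add: m_comm)
  have mul: "y \<otimes> x \<in> polys B x (Suc n)" if y0: "y \<in> polys B x (Suc n)" for y
  proof -
    obtain a z where y: "y = a \<otimes> x [^] n \<oplus> z" "a \<in> B" "z \<in> polys B x n"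
      using y0 by (auto simp: polys_Suc)
    have c: "a \<in> carrier R" "z \<in> carrier R" "x [^] n \<in> carrier R"
      using y polys_carrier[OF B xc] subring_carrier[OF B] xc by auto
    have "y \<otimes> x = a \<otimes> (x [^] n \<otimes> x) \<oplus> x \<otimes> z" unfolding y(1) using c xc by algebra
    moreover have "x \<otimes> z \<in> polys B x (Suc n)"
      using polys_pow_mult[OF B xc y(3), of 1] xc by simp
    ultimately show ?thesis
      using polys_add[OF B xc polys_scale[OF B xc y(2) n']] by simp
  qed
  have "y \<in> polys B x (Suc n)" if "y \<in> simple_extension B x" for y
    using that
  proof (induct rule: simple_extension.induct)
    case zero
    show ?case by (rule polys_zero[OF B xc])
  next
    case (lin k1 k2)
    then show ?case using mul polys_add[OF B xc] polys_const[OF B xc] by blast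
  qed
  then show ?thesis using that by blast
qed

text \<open>
  Transitivity of finiteness: the products \<open>g \<otimes> h\<close> generate over \<open>A\<close> what the \<open>h\<close> generate over \<open>B\<close>.
\<close>
lemma lin_comb_trans:
  assumes A: "subring A R" and gs: "set gs \<subseteq> carrier R" "B \<subseteq> lin_comb {\<zero>} A gs"
  shows "set hs \<subseteq> carrier R \<Longrightarrow>
    lin_comb {\<zero>} B hs \<subseteq> lin_comb {\<zero>} A (concat (map (\<lambda>h. map (\<lambda>g. g \<otimes> h) gs) hs))"
proof (induct hs)
  case (Cons h hs)
  have hc: "h \<in> carrier R" "set hs \<subseteq> carrier R" using Cons(2) by auto
  note Ac = subringE(1)[OF A]
  show ?case
  proof
    fix y assume "y \<in> lin_comb {\<zero>} B (h # hs)"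
    then obtain b z where y: "y = b \<otimes> h \<oplus> z" "b \<in> B" "z \<in> lin_comb {\<zero>} B hs" by auto
    have "b \<otimes> h \<in> lin_comb {\<zero>} A (map (\<lambda>g. g \<otimes> h) gs)"
      using lin_comb_map_mult[OF Ac hc(1) gs(1)] gs(2) y(2) by blast
    moreover have "z \<in> lin_comb {\<zero>} A (concat (map (\<lambda>h. map (\<lambda>g. g \<otimes> h) gs) hs))"
      using Cons(1)[OF hc(2)] y(3) by blast
    ultimately show "y \<in> lin_comb {\<zero>} A (concat (map (\<lambda>h. map (\<lambda>g. g \<otimes> h) gs) (h # hs)))"
      using lin_comb_append[OF Ac] hc gs(1) unfolding y(1) by (auto simp: subset_eq)
  qed
qed simp

lemma module_finite_simple_extension:
  assumes A: "subring A R" and B: "subring B R" and AB: "A \<subseteq> B"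
    and fin: "module_finite A B" and int: "integral_over B x"
  shows "module_finite A (simple_extension B x)"
proof -
  have xc: "x \<in> carrier R" using int unfolding integral_over_def by blast
  note E = simple_extension_subring[OF B xc]
  have incl: "B \<subseteq> simple_extension B x" "x \<in> simple_extension B x"
    using simple_extension_incl[OF subringE(1)[OF B] xc] simple_extension_mem[OF B xc] by auto
  obtain gs where gs: "set gs \<subseteq> B" "B \<subseteq> lin_comb {\<zero>} A gs" using fin unfolding module_finite_def by blast
  have gsc: "set gs \<subseteq> carrier R" using gs(1) subringE(1)[OF B] by blast
  obtain n where n: "simple_extension B x \<subseteq> polys B x n" using integral_simple_extension[OF B int] .
  have "simple_extension B x \<subseteq> lin_comb {\<zero>} A (concat (map (\<lambda>h. map (\<lambda>g. g \<otimes> h) gs) (pows x n)))"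
    using n lin_comb_trans[OF A gsc gs(2) pows_carrier[OF xc]] unfolding polys_def by blast
  moreover have "set (pows x m) \<subseteq> simple_extension B x" for m
    using subring_pow[OF E incl(2)] by (induct m) auto
  then have "set (concat (map (\<lambda>h. map (\<lambda>g. g \<otimes> h) gs) (pows x n))) \<subseteq> simple_extension B x"
    using gs(1) incl subring_closed(4)[OF E] by (fastforce simp: subset_eq)
  ultimately show ?thesis unfolding module_finite_def by blast
qed

section \<open>Coefficients of a relation over an integrally closed subring\<close>

text \<open>
  The powers of \<open>y\<close> in front turn each \<open>t [^] i\<close> into a power of \<open>y \<otimes> t\<close>; this is how the leading
  coefficient \<open>y\<close> of a relation for \<open>t\<close> makes \<open>y \<otimes> t\<close> integral.
\<close>
lemma polys_rescale:
  assumes A: "subring A R" and t: "t \<in> carrier R" and y: "y \<in> A"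
  shows "z \<in> polys A t n \<Longrightarrow> n \<le> Suc k \<Longrightarrow> y [^] k \<otimes> z \<in> polys A (y \<otimes> t) n"
proof (induct n arbitrary: z)
  case 0
  then show ?case using subring_carrier[OF A y] by simp
next
  case (Suc n)
  obtain a w where z: "z = a \<otimes> t [^] n \<oplus> w" "a \<in> A" "w \<in> polys A t n"
    using Suc(2) by (auto simp: polys_Suc)
  have yc: "y \<in> carrier R" using subring_carrier[OF A y] .
  have c: "a \<in> carrier R" "w \<in> carrier R" "t [^] n \<in> carrier R" "y [^] n \<in> carrier R" "y [^] (k - n) \<in> carrier R"
    using z polys_carrier[OF A t] subring_carrier[OF A] t yc by auto
  have "y [^] k = y [^] (k - n) \<otimes> y [^] n" using Suc(3) yc by (simp add: nat_pow_mult)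
  then have "y [^] k \<otimes> z = y [^] (k - n) \<otimes> y [^] n \<otimes> (a \<otimes> t [^] n) \<oplus> y [^] k \<otimes> w"
    unfolding z(1) using c by algebra
  also have "\<dots> = (y [^] (k - n) \<otimes> a) \<otimes> (y [^] n \<otimes> t [^] n) \<oplus> y [^] k \<otimes> w"
    using c by (simp add: m_ac)
  also have "\<dots> = (y [^] (k - n) \<otimes> a) \<otimes> (y \<otimes> t) [^] n \<oplus> y [^] k \<otimes> w"
    using yc t by (simp add: nat_pow_distrib)
  finally show ?case
    using polys_SucI[OF _ Suc(1)[OF z(3)]] subring_closed(4)[OF A subring_pow[OF A y] z(2)] Suc(3) by simp
qed

text \<open>
  Let \<open>y = c\<^sub>m t\<^sup>m + \<dots> + c\<^sub>0\<close> and suppose that \<open>y t\<^sup>n\<close> equals a polynomial in \<open>t\<close> of degree below \<open>n\<close>. Then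
  \<open>c\<^sub>m t\<close> is integral, so it lies in \<open>A\<close>; therefore \<open>(c\<^sub>m t + c\<^bsub>m-1\<^esub>) t\<close> is integral, so it
  lies in \<open>A\<close>, and so on. Thus all Horner partial values, and their products with \<open>t\<close>, lie in \<open>A\<close>.
  The induction on the Horner scheme runs through exactly these partial values, with \<open>n\<close> growing by one
  at each step inwards.
\<close>
lemma integral_collapse:
  assumes A: "subring A R" and t: "t \<in> carrier R"
    and closed: "\<And>y. y \<in> simple_extension A t \<Longrightarrow> integral_over A y \<Longrightarrow> y \<in> A"
  shows "y \<in> simple_extension A t \<Longrightarrow> y \<otimes> t [^] n \<in> polys A t n \<Longrightarrow> y \<in> A \<and> (0 < n \<longrightarrow> y \<otimes> t \<in> A)"
proof (induct arbitrary: n rule: simple_extension.induct)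
  case zero
  then show ?case using subring_closed(1)[OF A] t by simp
next
  case (lin k1 k2)
  note S = simple_extension_subring[OF A t]
  have tE: "t \<in> simple_extension A t" using simple_extension_mem[OF A t] .
  have c: "k1 \<in> carrier R" "k2 \<in> carrier R" "t [^] n \<in> carrier R"
    using lin subring_carrier[OF S] subring_carrier[OF A] t by auto
  let ?y = "k1 \<otimes> t \<oplus> k2"
  have yc: "?y \<in> carrier R" using c t by simp
  have "k1 \<otimes> t [^] Suc n = ?y \<otimes> t [^] n \<ominus> (k2 \<otimes> t [^] n \<oplus> \<zero>)"
    unfolding nat_pow_Suc using c t by algebra
  also have "\<dots> \<in> polys A t (Suc n)"
    by (intro polys_minus[OF A t] polys_Suc_mono[OF A t lin(4)] polys_SucI lin polys_zero[OF A t])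
  finally have k: "k1 \<in> A" "k1 \<otimes> t \<in> A" using lin(2) by blast+
  then have y: "?y \<in> A" using lin subring_closed(5)[OF A] by blast
  moreover have "?y \<otimes> t \<in> A" if "0 < n"
  proof (rule closed)
    show "?y \<otimes> t \<in> simple_extension A t"
      using simple_extension_incl[OF subringE(1)[OF A] t] y tE subring_closed(4)[OF S] by blast
    obtain m where m: "n = Suc m" using \<open>0 < n\<close> gr0_implies_Suc by blast
    have "(?y \<otimes> t) [^] n = ?y [^] m \<otimes> ?y \<otimes> t [^] n"
      using nat_pow_distrib[OF yc t, of n] unfolding m by simp
    also have "\<dots> = ?y [^] m \<otimes> (?y \<otimes> t [^] n)"
      using yc t by (simp add: m_assoc)
    also have "\<dots> \<in> polys A (?y \<otimes> t) n" by (rule polys_rescale[OF A t y lin(4)]) (simp add: m)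
    finally show "integral_over A (?y \<otimes> t)" unfolding integral_over_def using yc t by auto
  qed
  ultimately show ?case by blast
qed

end

section \<open>Extensions with FCP\<close>

locale FCP_extension = cring R for R (structure) + fixes K
  assumes subK: "subring K R" and FCP: "FCP K R"
begin

definition Kbar :: "'a set" where "Kbar = {x. integral_over K x}"

text \<open>
  FCP as an ascending chain condition: a finite chain contains its union, so Zorn's lemma applies to
  every nonempty set of intermediate rings.
\<close>
lemma maximal_intermediate:
  assumes "\<X> \<subseteq> intermediate_rings K R" and "\<X> \<noteq> {}"
  obtains B where "B \<in> \<X>" and "\<And>B'. B' \<in> \<X> \<Longrightarrow> B \<subseteq> B' \<Longrightarrow> B' = B"
proof -
  have "\<Union>\<C> \<in> \<X>" if "\<C> \<noteq> {}" and ch: "subset.chain \<X> \<C>" for \<C>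
  proof -
    have "\<C> \<in> chains (intermediate_rings K R)"
      using ch assms(1) unfolding subset_chain_def chains_def chain_subset_def by blast
    then have "finite \<C>" using FCP unfolding FCP_def by blast
    then have "\<Union>\<C> \<in> \<C>" using Union_in_chain[of \<C>] that by blast
    then show ?thesis using ch unfolding subset_chain_def by blast
  qed
  then show ?thesis using subset_Zorn_nonempty[OF assms(2)] that by metis
qed

text \<open>
  FCP as a descending chain condition, applied to the subrings \<open>A + z\<^sup>k B\<close>. This is the only
  descending chain that is used: below with \<open>B = A[z]\<close>, and with \<open>B\<close> the integral closure.
\<close>
lemma decreasing_power_chain:
  assumes A: "subring A R" "K \<subseteq> A" and B: "subring B R" "A \<subseteq> B" and z: "z \<in> B"
  obtains n where "0 < n"
    and "\<And>x. x \<in> B \<Longrightarrow> \<exists>a\<in>A. \<exists>y\<in>B. z [^] n \<otimes> x = a \<oplus> z [^] Suc n \<otimes> y"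
proof -
  note Ac = subring_carrier[OF A(1)] and Bc = subring_carrier[OF B(1)]
  note AE = subring_closed[OF A(1)] and BE = subring_closed[OF B(1)]
  define D where "D k = {a \<oplus> z [^] k \<otimes> y |a y. a \<in> A \<and> y \<in> B}" for k :: nat
  have zk: "z [^] k \<in> B" "z [^] k \<in> carrier R" for k :: nat using BE(7) z Bc by auto
  have D: "subring (D k) R" for k
  proof (rule subringI)
    show "D k \<subseteq> carrier R" unfolding D_def using zk Ac Bc by auto
    have "\<one> = \<one> \<oplus> z [^] k \<otimes> \<zero>" using zk by simp
    then show "\<one> \<in> D k" unfolding D_def using AE(2) BE(1) by blast
  next
    fix x assume "x \<in> D k"
    then obtain a y where x: "x = a \<oplus> z [^] k \<otimes> y" "a \<in> A" "y \<in> B" unfolding D_def by blast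
    have "\<ominus> x = \<ominus> a \<oplus> z [^] k \<otimes> (\<ominus> y)" unfolding x(1) using zk(2)[of k] Ac[OF x(2)] Bc[OF x(3)] by algebra
    then show "\<ominus> x \<in> D k" unfolding D_def using x AE(3) BE(3) by blast
  next
    fix x x' assume "x \<in> D k" "x' \<in> D k"
    then obtain a y a' y' where x: "x = a \<oplus> z [^] k \<otimes> y" "a \<in> A" "y \<in> B"
        "x' = a' \<oplus> z [^] k \<otimes> y'" "a' \<in> A" "y' \<in> B" unfolding D_def by blast
    note cc = zk(2)[of k] Ac[OF x(2)] Bc[OF x(3)] Ac[OF x(5)] Bc[OF x(6)]
    have "x \<oplus> x' = (a \<oplus> a') \<oplus> z [^] k \<otimes> (y \<oplus> y')" unfolding x using cc by algebra
    then show "x \<oplus> x' \<in> D k" unfolding D_def using x AE(5) BE(5) by blast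
    have "x \<otimes> x' = a \<otimes> a' \<oplus> z [^] k \<otimes> (a \<otimes> y' \<oplus> y \<otimes> a' \<oplus> z [^] k \<otimes> y \<otimes> y')"
      unfolding x using cc by algebra
    moreover have "a \<otimes> y' \<oplus> y \<otimes> a' \<oplus> z [^] k \<otimes> y \<otimes> y' \<in> B"
      using x B(2) zk BE(4,5) by (simp add: subset_eq)
    ultimately show "x \<otimes> x' \<in> D k" unfolding D_def using x AE(4) by blast
  qed
  have AD: "A \<subseteq> D k" for k
  proof
    fix a assume a: "a \<in> A"
    have "a = a \<oplus> z [^] k \<otimes> \<zero>" using zk Ac a by simp
    then show "a \<in> D k" unfolding D_def using a BE(1) by blast
  qed
  have "D (Suc k) \<subseteq> D k" for k
  proof
    fix x assume "x \<in> D (Suc k)"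
    then obtain a y where x: "x = a \<oplus> z [^] Suc k \<otimes> y" "a \<in> A" "y \<in> B" unfolding D_def by blast
    have "x = a \<oplus> z [^] k \<otimes> (z \<otimes> y)" unfolding x(1) using zk Ac Bc z x by (simp add: m_assoc)
    then show "x \<in> D k" unfolding D_def using x z BE(4) by blast
  qed
  then have anti: "D j \<subseteq> D i" if "i \<le> j" for i j using lift_Suc_antimono_le[of D] that by blast
  \<comment> \<open>The chain starts at exponent one, so that the exponent at which it becomes stable is positive.\<close>
  define f where "f k = D (Suc k)" for k
  have "range f \<in> chains (intermediate_rings K R)"
  proof -
    have "f i \<in> intermediate_rings K R" for i
      unfolding intermediate_rings_def f_def using D[of "Suc i"] AD[of "Suc i"] A(2) by simp
    moreover have "f i \<subseteq> f j \<or> f j \<subseteq> f i" for i j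
      unfolding f_def using anti[of "Suc i" "Suc j"] anti[of "Suc j" "Suc i"] by linarith
    ultimately show ?thesis unfolding chains_def chain_subset_def by auto
  qed
  then have "finite (range f)" using FCP unfolding FCP_def by blast
  then have "\<not> inj f" using finite_imageD by blast
  then obtain i j where "f i = f j" "i < j" unfolding inj_def by (metis nat_neq_iff)
  then have stable: "D (Suc i) \<subseteq> D (Suc (Suc i))"
    using anti[of "Suc (Suc i)" "Suc j"] unfolding f_def by auto
  show ?thesis
  proof (rule that[of "Suc i"])
    fix x assume x: "x \<in> B"
    have "z [^] Suc i \<otimes> x = \<zero> \<oplus> z [^] Suc i \<otimes> x" using zk(2)[of "Suc i"] Bc x by simp
    then have "z [^] Suc i \<otimes> x \<in> D (Suc i)" unfolding D_def using x AE(1) by blast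
    then show "\<exists>a\<in>A. \<exists>y\<in>B. z [^] Suc i \<otimes> x = a \<oplus> z [^] Suc (Suc i) \<otimes> y"
      using stable unfolding D_def by blast
  qed simp
qed

text \<open>
  A maximal module-finite intermediate ring \<open>B\<close> contains every element \<open>x\<close> that is integral over it, as \<open>B[x]\<close> is
  again module-finite. Since the elements of \<open>B\<close> are integral over \<open>K\<close>, \<open>B\<close> is the integral closure. This
  shows at one stroke that the integral closure is a subring, is finite over \<open>K\<close> and is integrally closed.
\<close>
lemma integral_closure_properties:
  shows Kbar_subring: "subring Kbar R"
    and Kbar_finite: "module_finite K Kbar"
    and Kbar_closed: "\<And>x. integral_over Kbar x \<Longrightarrow> x \<in> Kbar"
proof -
  let ?X = "{B. subring B R \<and> K \<subseteq> B \<and> module_finite K B}"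
  have "?X \<subseteq> intermediate_rings K R" unfolding intermediate_rings_def by blast
  moreover have "?X \<noteq> {}" using subK module_finite_self[OF subK] by blast
  ultimately obtain B where B: "B \<in> ?X" and max: "\<And>B'. B' \<in> ?X \<Longrightarrow> B \<subseteq> B' \<Longrightarrow> B' = B"
    by (rule maximal_intermediate) blast
  have closed: "x \<in> B" if int: "integral_over B x" for x
  proof -
    have xc: "x \<in> carrier R" using int unfolding integral_over_def by blast
    have sub: "subring B R" "K \<subseteq> B" and fin: "module_finite K B" using B by auto
    have incl: "B \<subseteq> simple_extension B x" "x \<in> simple_extension B x"
      using simple_extension_incl[OF subringE(1)[OF sub(1)] xc] simple_extension_mem[OF sub(1) xc] by auto
    have "simple_extension B x \<in> ?X"
      using simple_extension_subring[OF sub(1) xc] module_finite_simple_extension[OF subK sub fin int]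
        incl sub(2) by blast
    then show ?thesis using max incl by blast
  qed
  have "Kbar = B"
  proof
    show "B \<subseteq> Kbar" unfolding Kbar_def using module_finite_integral[OF subK] B by blast
    show "Kbar \<subseteq> B" unfolding Kbar_def using closed integral_over_mono B by blast
  qed
  then show "subring Kbar R" "module_finite K Kbar" "\<And>x. integral_over Kbar x \<Longrightarrow> x \<in> Kbar"
    using B closed by auto
qed

lemma K_le_Kbar: "K \<subseteq> Kbar"
  unfolding Kbar_def using integral_over_self[OF subK] by blast

text \<open>
  An integrally closed part of an FCP extension is a Pruefer extension, in the form that
  \<open>A + A t\<close> is invertible, with inverse \<open>{j \<in> A. j \<otimes> t \<in> A}\<close>. The chain \<open>A + t\<^sup>k A[t]\<close> gives a relation
  \<open>t\<^sup>n = a + t\<^bsup>n+1\<^esup> g\<close>. It bounds the degree of \<open>g t\<^bsup>n+1\<^esup>\<close> and of \<open>(1 - g t) t\<^sup>n\<close>, so by \<open>integral_collapse\<close>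
  both \<open>g\<close> and \<open>1 - g t\<close> lie in \<open>A\<close> and multiply \<open>t\<close> into \<open>A\<close>.
\<close>
lemma pruefer:
  assumes A: "subring A R" "K \<subseteq> A" and B: "subring B R" "A \<subseteq> B"
    and closed: "\<And>x. x \<in> B \<Longrightarrow> integral_over A x \<Longrightarrow> x \<in> A"
    and t: "t \<in> B"
  obtains a b where "a \<in> A" "b \<in> A" "a \<otimes> t \<in> A" "b \<otimes> t \<in> A" "a \<oplus> b \<otimes> t = \<one>"
proof -
  have tc: "t \<in> carrier R" using subring_carrier[OF B(1) t] .
  let ?E = "simple_extension A t"
  have E: "subring ?E R" "A \<subseteq> ?E" "t \<in> ?E" "?E \<subseteq> B"
    using simple_extension_subring[OF A(1) tc] simple_extension_incl[OF subringE(1)[OF A(1)] tc]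
      simple_extension_mem[OF A(1) tc] simple_extension_subring_incl[OF B t] by auto
  have collapse: "y \<in> A \<and> (0 < n \<longrightarrow> y \<otimes> t \<in> A)" if "y \<in> ?E" "y \<otimes> t [^] n \<in> polys A t n" for y n
    by (rule integral_collapse[OF A(1) tc _ that]) (use closed E(4) in blast)
  obtain n where n: "0 < n"
    and chain: "\<And>x. x \<in> ?E \<Longrightarrow> \<exists>a\<in>A. \<exists>y\<in>?E. t [^] n \<otimes> x = a \<oplus> t [^] Suc n \<otimes> y"
    using decreasing_power_chain[OF A E(1-3)] by blast
  obtain m where m: "n = Suc m" using n gr0_implies_Suc by blast
  obtain a g where ag: "a \<in> A" "g \<in> ?E" "t [^] n \<otimes> \<one> = a \<oplus> t [^] Suc n \<otimes> g"
    using chain[OF subring_closed(2)[OF E(1)]] by blast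
  have c: "a \<in> carrier R" "g \<in> carrier R" "t [^] n \<in> carrier R"
    using ag subring_carrier[OF A(1)] subring_carrier[OF E(1)] tc by auto
  have aP: "a \<in> polys A t n" unfolding m using polys_const[OF A(1) tc ag(1)] .
  have e: "t [^] n = a \<oplus> g \<otimes> t [^] Suc n"
    using ag(3) c tc by (simp add: m_comm[of g])
  have "g \<otimes> t [^] Suc n = (a \<oplus> g \<otimes> t [^] Suc n) \<ominus> a" unfolding nat_pow_Suc using c tc by algebra
  also have "\<dots> = (\<one> \<otimes> t [^] n \<oplus> \<zero>) \<ominus> a" using e[symmetric] c by simp
  also have "\<dots> \<in> polys A t (Suc n)"
    by (intro polys_minus[OF A(1) tc] polys_SucI subring_closed(2)[OF A(1)] polys_zero[OF A(1) tc]
        polys_Suc_mono[OF A(1) tc aP])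
  finally have g: "g \<in> A" "g \<otimes> t \<in> A" using collapse[OF ag(2)] by blast+
  define h where "h = \<one> \<ominus> g \<otimes> t"
  have h: "h \<in> A" unfolding h_def using g subring_closed(2,6)[OF A(1)] by blast
  have "h \<otimes> t [^] n = t [^] n \<ominus> g \<otimes> t [^] Suc n" unfolding h_def nat_pow_Suc using c tc by algebra
  also have "\<dots> = (a \<oplus> g \<otimes> t [^] Suc n) \<ominus> g \<otimes> t [^] Suc n" using e by simp
  also have "\<dots> = a" unfolding nat_pow_Suc using c tc by algebra
  finally have "h \<otimes> t [^] n = a" .
  then have "h \<otimes> t \<in> A" using collapse[of h n] h E(2) aP n by auto
  moreover have "h \<oplus> g \<otimes> t = \<one>" unfolding h_def using c tc by algebra
  ultimately show ?thesis using that g h by blast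
qed

text \<open>
  The integral and the Pruefer part of an FCP extension live at different primes. Let \<open>A\<close> be \<open>T \<inter> Kbar\<close> and
  \<open>J = {j \<in> A. j \<otimes> t \<in> A}\<close>. Then the conductor of \<open>A\<close> in \<open>Kbar\<close> is comaximal to \<open>J\<close>: it contains an
  element of \<open>1 + J\<close>.
  
  By Nakayama it suffices that \<open>Kbar = A + J Kbar\<close>. Now \<open>a + b t = 1\<close> with \<open>a\<close>, \<open>b\<close> in \<open>J\<close>, and the chain
  \<open>A + b\<^sup>k Kbar\<close> gives \<open>b\<^sup>n x = r + b\<^bsup>n+1\<^esup> y\<close> for every \<open>x\<close> in \<open>Kbar\<close>. Multiplied by \<open>t\<^sup>n\<close> this says that
  \<open>(b t)\<^sup>n (x - b y) = t\<^sup>n r\<close>, where the left side is in \<open>Kbar\<close> and the right side in \<open>T\<close>, so that it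
  lies in \<open>A\<close>. As \<open>b t\<close> is 1 modulo \<open>a\<close>, this puts \<open>x\<close> into \<open>A + a Kbar + b Kbar\<close>.
\<close>
lemma comaximal_conductor:
  assumes T: "subring T R" "K \<subseteq> T" and t: "t \<in> T"
  obtains e where "e \<in> T \<inter> Kbar" and "\<forall>c\<in>Kbar. e \<otimes> c \<in> T \<inter> Kbar" and "(\<one> \<ominus> e) \<otimes> t \<in> T \<inter> Kbar"
proof -
  define A where "A = T \<inter> Kbar"
  have A: "subring A R" "K \<subseteq> A" "A \<subseteq> T" "A \<subseteq> Kbar"
    unfolding A_def using subring_inter[OF T(1) Kbar_subring] T(2) K_le_Kbar by auto
  note Ac = subring_carrier[OF A(1)] and Cc = subring_carrier[OF Kbar_subring]
  note AE = subring_closed[OF A(1)] and CE = subring_closed[OF Kbar_subring] and TE = subring_closed[OF T(1)]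
  have tc: "t \<in> carrier R" using subring_carrier[OF T(1) t] .
  have "x \<in> A" if "x \<in> T" "integral_over A x" for x
    using Kbar_closed[OF integral_over_mono[OF A(4) that(2)]] that(1) unfolding A_def by simp
  then obtain a b where ab: "a \<in> A" "b \<in> A" "a \<otimes> t \<in> A" "b \<otimes> t \<in> A" "a \<oplus> b \<otimes> t = \<one>"
    using pruefer[OF A(1,2) T(1) A(3) _ t] by metis
  have abc: "a \<in> carrier R" "b \<in> carrier R" using ab Ac by auto
  obtain n where chain: "\<And>x. x \<in> Kbar \<Longrightarrow> \<exists>r\<in>A. \<exists>y\<in>Kbar. b [^] n \<otimes> x = r \<oplus> b [^] Suc n \<otimes> y"
    using decreasing_power_chain[OF A(1,2) Kbar_subring A(4)] ab(2) A(4) by blast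
  have "\<exists>q\<in>A. (b \<otimes> t) [^] m = \<one> \<ominus> a \<otimes> q" for m :: nat
  proof (induct m)
    case 0
    show ?case by (rule bexI[of _ \<zero>]) (use abc AE in \<open>auto simp: a_minus_def\<close>)
  next
    case (Suc m)
    then obtain q where q: "q \<in> A" "(b \<otimes> t) [^] m = \<one> \<ominus> a \<otimes> q" by blast
    have qc: "q \<in> carrier R" using q Ac by auto
    have bt: "b \<otimes> t = \<one> \<ominus> a"
    proof -
      have "b \<otimes> t = (a \<oplus> b \<otimes> t) \<ominus> a" using abc tc by algebra
      then show ?thesis using ab(5) by simp
    qed
    have "(b \<otimes> t) [^] Suc m = (\<one> \<ominus> a \<otimes> q) \<otimes> (\<one> \<ominus> a)" using q(2) bt by simp
    also have "\<dots> = \<one> \<ominus> a \<otimes> (\<one> \<oplus> q \<ominus> a \<otimes> q)" using abc qc by algebra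
    finally show ?case using AE(2)  AE(4)[OF ab(1) q(1)] AE(5)[OF AE(2) q(1)] AE(6) by blast
  qed
  then obtain q where q: "q \<in> A" "(b \<otimes> t) [^] n = \<one> \<ominus> a \<otimes> q" by blast
  have split: "\<exists>r\<in>A. \<exists>c\<in>Kbar. \<exists>c'\<in>Kbar. x = r \<oplus> (a \<otimes> c \<oplus> b \<otimes> c')" if x: "x \<in> Kbar" for x
  proof -
    obtain r y where ry: "r \<in> A" "y \<in> Kbar" "b [^] n \<otimes> x = r \<oplus> b [^] Suc n \<otimes> y" using chain[OF x] by blast
    have c: "r \<in> carrier R" "y \<in> carrier R" "x \<in> carrier R" "q \<in> carrier R"
      "b [^] n \<in> carrier R" "t [^] n \<in> carrier R" using ry x q Ac Cc abc tc by auto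
    \<comment> \<open>\<open>w\<close> is \<open>x\<close> modulo \<open>a Kbar + b Kbar\<close>, and it lies in \<open>T\<close> as it equals \<open>t\<^sup>n r\<close>.\<close>
    define w where "w = (b \<otimes> t) [^] n \<otimes> (x \<ominus> b \<otimes> y)"
    have "w = t [^] n \<otimes> (b [^] n \<otimes> x \<ominus> b [^] Suc n \<otimes> y)"
      unfolding w_def nat_pow_distrib[OF abc(2) tc] nat_pow_Suc using c abc by algebra
    also have "\<dots> = t [^] n \<otimes> r" unfolding ry(3) nat_pow_Suc using c abc by algebra
    finally have "w \<in> T" using TE(4,7) t ry(1) A(3) by auto
    moreover have "w \<in> Kbar" unfolding w_def using CE(4,6,7) ab ry x A(4) by (simp add: subset_eq)
    ultimately have w: "w \<in> A" unfolding A_def by blast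
    have "x = (\<one> \<ominus> a \<otimes> q) \<otimes> (x \<ominus> b \<otimes> y) \<oplus> (a \<otimes> (q \<otimes> (x \<ominus> b \<otimes> y)) \<oplus> b \<otimes> y)"
      using c abc by algebra
    then have "x = w \<oplus> (a \<otimes> (q \<otimes> (x \<ominus> b \<otimes> y)) \<oplus> b \<otimes> y)" unfolding w_def q(2) .
    moreover have "q \<otimes> (x \<ominus> b \<otimes> y) \<in> Kbar" using CE(4,6) ab ry x q A(4) by (simp add: subset_eq)
    ultimately show ?thesis using w ry(2) by blast
  qed
  define J where "J = {j \<in> A. j \<otimes> t \<in> A}"
  have Jc: "J \<subseteq> carrier R" and JA: "J \<subseteq> A" unfolding J_def using Ac by auto
  have Jadd: "i \<oplus> j \<in> J" if "i \<in> J" "j \<in> J" for i j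
    using that AE Ac tc unfolding J_def by (auto simp: l_distr)
  have Jmult: "r \<otimes> j \<in> J" if "r \<in> A" "j \<in> J" for r j
    using that AE Ac tc unfolding J_def by (auto simp: m_assoc)
  define P where "P = {p \<in> A. \<one> \<ominus> p \<in> J}"
  have Pc: "P \<subseteq> carrier R" and PA: "P \<subseteq> A" unfolding P_def using Ac by auto
  obtain gs where gs: "set gs \<subseteq> Kbar" "Kbar \<subseteq> lin_comb {\<zero>} K gs" using Kbar_finite unfolding module_finite_def by blast
  have gsc: "set gs \<subseteq> carrier R" using gs(1) Cc by blast
  have Asub: "A \<subseteq> carrier R" using Ac by blast
  have zJ: "\<zero> \<in> J" unfolding J_def using AE(1) tc by simp
  have gsA: "Kbar \<subseteq> lin_comb {\<zero>} A gs" using gs(2) lin_comb_mono[of "{\<zero>}" "{\<zero>}" K A gs] A(2) by blast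
  have JC: "j \<otimes> c \<in> lin_comb A J gs" if "j \<in> J" "c \<in> Kbar" for j c
  proof (rule lin_comb_scale[of "{\<zero>}" A j A J, OF _ Asub _ _ _ gsc])
    show "\<And>x. x \<in> A \<Longrightarrow> j \<otimes> x \<in> J" using Jmult[of _ j] that(1) Jc Ac by (auto simp: m_comm subset_eq)
  qed (use that gsA Jc AE(1) in auto)
  have ladd: "x \<oplus> y \<in> lin_comb A J gs" if "x \<in> lin_comb A J gs" "y \<in> lin_comb A J gs" for x y
    by (rule lin_comb_add[OF Asub Jc AE(5) Jadd gsc that])
  have rows: "\<exists>n. \<exists>p\<in>P. p \<otimes> g \<in> lin_comb A J gs" if g: "g \<in> set gs" for g
  proof (intro exI bexI)
    obtain r c c' where r: "r \<in> A" "c \<in> Kbar" "c' \<in> Kbar" "g = r \<oplus> (a \<otimes> c \<oplus> b \<otimes> c')"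
      using split gs(1) g by blast
    have "a \<in> J" "b \<in> J" unfolding J_def using ab by auto
    moreover have "r \<in> lin_comb A J gs" using lin_comb_base[OF Asub zJ gsc] r(1) by blast
    ultimately have "g \<in> lin_comb A J gs" unfolding r(4) using r ladd JC by blast
    then show "\<one> \<otimes> g \<in> lin_comb A J gs" using gsc g by auto
    show "\<one> \<in> P" unfolding P_def using AE(2) zJ by (simp add: a_minus_def r_neg)
  qed
  have "\<exists>n::nat. \<exists>p\<in>P. \<forall>g\<in>set gs. p \<otimes> g \<in> A"
  proof (rule elimination[where P = "\<lambda>_. P" and Q = "\<lambda>_. J", OF Asub AE(5) Pc Jc _ _ _ Jadd _ _ _ _ gsc rows])
    show "\<one> \<in> P" unfolding P_def using AE(2) zJ by (simp add: a_minus_def r_neg)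
  next
    fix p q assume pq: "p \<in> P" "q \<in> J"
    have "p \<in> carrier R" "q \<in> carrier R" using pq Pc Jc by auto
    then have "\<one> \<ominus> (p \<ominus> q) = (\<one> \<ominus> p) \<oplus> q" by algebra
    then show "p \<ominus> q \<in> P" using pq Jadd JA AE(6) unfolding P_def by auto
  next
    fix p q assume pq: "p \<in> P" "q \<in> P"
    have "p \<in> carrier R" "q \<in> carrier R" using pq Pc by auto
    then have "\<one> \<ominus> p \<otimes> q = (\<one> \<ominus> p) \<oplus> p \<otimes> (\<one> \<ominus> q)" by algebra
    then show "p \<otimes> q \<in> P" using pq Jadd Jmult AE(4) unfolding P_def by auto
  qed (use PA JA Jmult AE in \<open>auto simp: subset_eq\<close>)
  then obtain e where e: "e \<in> P" "\<And>g. g \<in> set gs \<Longrightarrow> e \<otimes> g \<in> A" by blast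
  have "e \<otimes> c \<in> A" if "c \<in> Kbar" for c
    by (rule lin_comb_into[where M = "{\<zero>}" and Q = A and gs = gs, OF _ Asub])
      (use e gsA that AE Pc gsc in \<open>auto simp: subset_eq\<close>)
  then show ?thesis using that e(1) unfolding P_def J_def A_def by blast
qed

end

context cring
begin

section \<open>Composita\<close>

lemma compositum_subring:
  assumes "subring T R" "subring U R"
  shows "subring (compositum R T U) R"
  unfolding compositum_def
  by (rule generate_ring_is_subring) (use subringE(1)[OF assms(1)] subringE(1)[OF assms(2)] in simp)

lemma compositum_upper: "T \<subseteq> compositum R T U" "U \<subseteq> compositum R T U"
  unfolding compositum_def by (auto intro: generate_ring.incl)

lemma compositum_least:
  assumes "subring E R" "T \<subseteq> E" "U \<subseteq> E"
  shows "compositum R T U \<subseteq> E"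
  unfolding compositum_def
  by (rule generate_ring_min_subring1[OF _ assms(1)]) (use assms(2,3) subringE(1)[OF assms(1)] in auto)

lemma compositum_mono:
  assumes "subring T' R" "subring U' R" "T \<subseteq> T'" "U \<subseteq> U'"
  shows "compositum R T U \<subseteq> compositum R T' U'"
  by (rule compositum_least[OF compositum_subring[OF assms(1,2)]
        subset_trans[OF assms(3) compositum_upper(1)] subset_trans[OF assms(4) compositum_upper(2)]])

lemma compositum_eq_sum:
  assumes T: "subring T R" and U: "subring U R"
    and mult: "\<And>t u. t \<in> T \<Longrightarrow> u \<in> U \<Longrightarrow> \<exists>t'\<in>T. \<exists>u'\<in>U. t \<otimes> u = t' \<oplus> u'"
    and x: "x \<in> compositum R T U"
  obtains t u where "t \<in> T" "u \<in> U" "x = t \<oplus> u"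
proof -
  note Tc = subring_carrier[OF T] and Uc = subring_carrier[OF U]
  note TE = subring_closed[OF T] and UE = subring_closed[OF U]
  define E where "E = {t \<oplus> u |t u. t \<in> T \<and> u \<in> U}"
  have add: "x \<oplus> y \<in> E" if xy: "x \<in> E" "y \<in> E" for x y
  proof -
    obtain t u t' u' where *: "x = t \<oplus> u" "t \<in> T" "u \<in> U" "y = t' \<oplus> u'" "t' \<in> T" "u' \<in> U"
      using xy unfolding E_def by blast
    have "t \<in> carrier R" "u \<in> carrier R" "t' \<in> carrier R" "u' \<in> carrier R" using * Tc Uc by auto
    then have "x \<oplus> y = (t \<oplus> t') \<oplus> (u \<oplus> u')" unfolding *(1,4) by algebra
    then show ?thesis unfolding E_def using TE(5)[OF *(2,5)] UE(5)[OF *(3,6)] by blast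
  qed
  have TE': "T \<subseteq> E"
  proof
    fix t assume t: "t \<in> T"
    then have "t = t \<oplus> \<zero>" using Tc by simp
    then show "t \<in> E" unfolding E_def using t UE(1) by blast
  qed
  have UE': "U \<subseteq> E"
  proof
    fix u assume u: "u \<in> U"
    then have "u = \<zero> \<oplus> u" using Uc by simp
    then show "u \<in> E" unfolding E_def using u TE(1) by blast
  qed
  have TU: "t \<otimes> u \<in> E" if "t \<in> T" "u \<in> U" for t u
    using mult[OF that] unfolding E_def by blast
  have "subring E R"
  proof (rule subringI)
    show "E \<subseteq> carrier R" unfolding E_def using Tc Uc by auto
    show "\<one> \<in> E" using TE' TE(2) by blast
  next
    fix x assume "x \<in> E"
    then obtain t u where *: "x = t \<oplus> u" "t \<in> T" "u \<in> U" unfolding E_def by blast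
    have "\<ominus> x = \<ominus> t \<oplus> \<ominus> u" unfolding *(1) using Tc[OF *(2)] Uc[OF *(3)] by algebra
    then show "\<ominus> x \<in> E" unfolding E_def using TE(3)[OF *(2)] UE(3)[OF *(3)] by blast
  next
    fix x y assume xy: "x \<in> E" "y \<in> E"
    then obtain t u t' u' where *: "x = t \<oplus> u" "t \<in> T" "u \<in> U" "y = t' \<oplus> u'" "t' \<in> T" "u' \<in> U"
      unfolding E_def by blast
    have "t \<in> carrier R" "u \<in> carrier R" "t' \<in> carrier R" "u' \<in> carrier R" using * Tc Uc by auto
    then have "x \<otimes> y = (t \<otimes> t' \<oplus> t \<otimes> u') \<oplus> (t' \<otimes> u \<oplus> u \<otimes> u')" unfolding *(1,4) by algebra
    moreover have "t \<otimes> t' \<in> E" "u \<otimes> u' \<in> E" using * TE(4) UE(4) TE' UE' by auto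
    ultimately show "x \<otimes> y \<in> E" using add TU * by simp
  qed (rule add)
  then have "x \<in> E" using compositum_least[OF _ TE' UE'] x by blast
  then show ?thesis using that unfolding E_def by blast
qed

lemma subring_of_subring_iff:
  assumes "subring B R"
  shows "subring T (R\<lparr>carrier := B\<rparr>) \<longleftrightarrow> subring T R \<and> T \<subseteq> B"
proof -
  interpret B: ring "R\<lparr>carrier := B\<rparr>" by (rule subring_is_ring[OF assms])
  show ?thesis
    using B.subring_iff[of T] subring_iff[of T] subringE(1)[of T] subringE(1)[of T "R\<lparr>carrier := B\<rparr>"]
      subringE(1)[OF assms] by auto
qed

lemma compositum_in_subring:
  assumes "subring B R" "T \<subseteq> B" "U \<subseteq> B"
  shows "compositum (R\<lparr>carrier := B\<rparr>) T U = compositum R T U"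
  using subring_gen_incl[OF assms(1) carrier_is_subring, of "T \<union> U"]
    subring_gen_incl[OF carrier_is_subring assms(1), of "T \<union> U"] assms(2,3) subringE(1)[OF assms(1)]
  unfolding compositum_def by auto

lemma intermediate_rings_subring:
  assumes "subring B R"
  shows "intermediate_rings A (R\<lparr>carrier := B\<rparr>) = {T \<in> intermediate_rings A R. T \<subseteq> B}"
  unfolding intermediate_rings_def subring_of_subring_iff[OF assms] by blast

lemma distributive_extension_subring:
  assumes "subring B R"
  shows "distributive_extension A (R\<lparr>carrier := B\<rparr>) \<longleftrightarrow>
    (\<forall>T\<in>intermediate_rings A R. \<forall>U\<in>intermediate_rings A R. \<forall>V\<in>intermediate_rings A R.
      T \<subseteq> B \<longrightarrow> U \<subseteq> B \<longrightarrow> V \<subseteq> B \<longrightarrow>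
      T \<inter> compositum R U V = compositum R (T \<inter> U) (T \<inter> V))"
proof -
  have "T \<inter> compositum (R\<lparr>carrier := B\<rparr>) U V = compositum (R\<lparr>carrier := B\<rparr>) (T \<inter> U) (T \<inter> V)
    \<longleftrightarrow> T \<inter> compositum R U V = compositum R (T \<inter> U) (T \<inter> V)"
    if "U \<subseteq> B" "V \<subseteq> B" for T U V
    using compositum_in_subring[OF assms] that by (simp add: le_infI2)
  then show ?thesis
    unfolding distributive_extension_def intermediate_rings_subring[OF assms] Ball_def mem_Collect_eq
    by meson
qed

end

section \<open>The integral closure as a neutral element of the lattice\<close>

context FCP_extension
begin

text \<open>
  With \<open>e\<close> in the conductor and \<open>1 - e\<close> multiplying \<open>t\<close> into \<open>Kbar\<close>, a product splits as
  \<open>t c = (e c) t + ((1 - e) t) c\<close> into an element of \<open>T\<close> and one of \<open>Kbar\<close>.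
\<close>
lemma join_Kbar_eq_sum:
  assumes T: "subring T R" "K \<subseteq> T" and x: "x \<in> compositum R T Kbar"
  obtains t c where "t \<in> T" "c \<in> Kbar" "x = t \<oplus> c"
proof (rule compositum_eq_sum[OF T(1) Kbar_subring _ x])
  fix t c assume t: "t \<in> T" and c: "c \<in> Kbar"
  obtain e where e: "e \<in> T \<inter> Kbar" "e \<otimes> c \<in> T \<inter> Kbar" "(\<one> \<ominus> e) \<otimes> t \<in> T \<inter> Kbar"
    using comaximal_conductor[OF T t] c by metis
  have "t \<in> carrier R" "c \<in> carrier R" "e \<in> carrier R"
    using t c e subring_carrier[OF T(1)] subring_carrier[OF Kbar_subring] by auto
  then have "t \<otimes> c = (e \<otimes> c) \<otimes> t \<oplus> (\<one> \<ominus> e) \<otimes> t \<otimes> c" by algebra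
  moreover have "(e \<otimes> c) \<otimes> t \<in> T" "(\<one> \<ominus> e) \<otimes> t \<otimes> c \<in> Kbar"
    using e t c subring_closed(4)[OF T(1)] subring_closed(4)[OF Kbar_subring] by auto
  ultimately show "\<exists>t'\<in>T. \<exists>u'\<in>Kbar. t \<otimes> c = t' \<oplus> u'" by blast
qed (rule that)

text \<open>
  For a fixed \<open>x\<close> in \<open>Kbar\<close>, those \<open>w\<close> for which the conductors \<open>(A : x)\<close> and \<open>(A : w)\<close> are comaximal
  form a subring \<open>W\<close>. It contains \<open>T\<close> and \<open>U\<close>, hence their compositum. If \<open>x\<close> itself is in \<open>W\<close>, then \<open>(A : x)\<close>
  is comaximal to itself, so it is the unit ideal.
\<close>
lemma meet_Kbar_join:
  assumes T: "subring T R" "K \<subseteq> T" and U: "subring U R" "K \<subseteq> U"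
    and x: "x \<in> compositum R T U" "x \<in> Kbar"
  shows "x \<in> compositum R (T \<inter> Kbar) (U \<inter> Kbar)"
proof -
  define A where "A = compositum R (T \<inter> Kbar) (U \<inter> Kbar)"
  have A: "subring A R"
    unfolding A_def by (intro compositum_subring subring_inter T U Kbar_subring)
  note Ac = subring_carrier[OF A] and AE = subring_closed[OF A]
  have TA: "T \<inter> Kbar \<subseteq> A" "U \<inter> Kbar \<subseteq> A" unfolding A_def by (rule compositum_upper)+
  have xc: "x \<in> carrier R" using subring_carrier[OF Kbar_subring x(2)] .
  define W where "W = {w \<in> carrier R. \<exists>e\<in>A. e \<otimes> x \<in> A \<and> (\<one> \<ominus> e) \<otimes> w \<in> A}"
  have inW: "B \<subseteq> W" if B: "subring B R" "K \<subseteq> B" and BA: "B \<inter> Kbar \<subseteq> A" for B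
  proof
    fix w assume w: "w \<in> B"
    obtain e where "e \<in> B \<inter> Kbar" "e \<otimes> x \<in> B \<inter> Kbar" "(\<one> \<ominus> e) \<otimes> w \<in> B \<inter> Kbar"
      using comaximal_conductor[OF B w] x(2) by (metis (no_types, lifting))
    then show "w \<in> W" unfolding W_def using BA w subring_carrier[OF B(1)] by blast
  qed
  have WW: "v \<oplus> w \<in> W \<and> v \<otimes> w \<in> W" if vw: "v \<in> W" "w \<in> W" for v w
  proof -
    obtain e where e: "e \<in> A" "e \<otimes> x \<in> A" "(\<one> \<ominus> e) \<otimes> v \<in> A" using vw(1) unfolding W_def by blast
    obtain f where f: "f \<in> A" "f \<otimes> x \<in> A" "(\<one> \<ominus> f) \<otimes> w \<in> A" using vw(2) unfolding W_def by blast
    have c: "v \<in> carrier R" "w \<in> carrier R" "e \<in> carrier R" "f \<in> carrier R"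
      using vw e f Ac unfolding W_def by auto
    \<comment> \<open>chosen so that \<open>\<one> \<ominus> g\<close> is the product of \<open>\<one> \<ominus> e\<close> and \<open>\<one> \<ominus> f\<close>\<close>
    define g where "g = e \<oplus> f \<ominus> e \<otimes> f"
    have gA: "g \<in> A" unfolding g_def using e(1) f(1) AE(4,5,6) by simp
    have "g \<otimes> x = e \<otimes> x \<oplus> f \<otimes> x \<ominus> e \<otimes> (f \<otimes> x)" unfolding g_def using c xc by algebra
    then have gx: "g \<otimes> x \<in> A" using e f AE(4,5,6) by simp
    have "(\<one> \<ominus> g) \<otimes> (v \<oplus> w) = (\<one> \<ominus> f) \<otimes> ((\<one> \<ominus> e) \<otimes> v) \<oplus> (\<one> \<ominus> e) \<otimes> ((\<one> \<ominus> f) \<otimes> w)"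
      unfolding g_def using c by algebra
    then have "(\<one> \<ominus> g) \<otimes> (v \<oplus> w) \<in> A" using e f AE(2,4,5,6) by simp
    moreover have "(\<one> \<ominus> g) \<otimes> (v \<otimes> w) = ((\<one> \<ominus> e) \<otimes> v) \<otimes> ((\<one> \<ominus> f) \<otimes> w)"
      unfolding g_def using c by algebra
    then have "(\<one> \<ominus> g) \<otimes> (v \<otimes> w) \<in> A" using e f AE(4) by simp
    ultimately show ?thesis unfolding W_def using gA gx c by blast
  qed
  have "subring W R"
  proof (rule subringI)
    show "W \<subseteq> carrier R" unfolding W_def by blast
    show "\<one> \<in> W" using inW[OF T TA(1)] subring_closed(2)[OF T(1)] by blast
  next
    fix w assume "w \<in> W"
    then obtain e where e: "w \<in> carrier R" "e \<in> A" "e \<otimes> x \<in> A" "(\<one> \<ominus> e) \<otimes> w \<in> A"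
      unfolding W_def by blast
    have "(\<one> \<ominus> e) \<otimes> (\<ominus> w) = \<ominus> ((\<one> \<ominus> e) \<otimes> w)" using e Ac by (simp add: r_minus)
    then show "\<ominus> w \<in> W" unfolding W_def using e AE(3) by auto
  qed (use WW in blast)+
  then have "x \<in> W" using compositum_least[OF _ inW[OF T TA(1)] inW[OF U TA(2)]] x(1) by blast
  then obtain e where e: "e \<in> A" "e \<otimes> x \<in> A" "(\<one> \<ominus> e) \<otimes> x \<in> A" unfolding W_def by blast
  have "x = e \<otimes> x \<oplus> (\<one> \<ominus> e) \<otimes> x" using Ac[OF e(1)] xc by algebra
  then show ?thesis using e AE(5) unfolding A_def by metis
qed

text \<open>
  Take \<open>e\<close> in the conductor of \<open>T \<inter> Kbar\<close> with \<open>(1 - e) x\<close> in \<open>Kbar\<close>, and \<open>f\<close> likewise for \<open>U\<close>. Conductors are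
  ideals of \<open>Kbar\<close>, so \<open>e f\<close> lies in both, and it multiplies \<open>x\<close> into \<open>T \<inter> U\<close>, while \<open>1 - e f\<close> still
  multiplies \<open>x\<close> into \<open>Kbar\<close>.
\<close>
lemma join_Kbar_meet:
  assumes T: "subring T R" "K \<subseteq> T" and U: "subring U R" "K \<subseteq> U"
    and x: "x \<in> compositum R T Kbar" "x \<in> compositum R U Kbar"
  shows "x \<in> compositum R (T \<inter> U) Kbar"
proof -
  note Tc = subring_carrier[OF T(1)] and Uc = subring_carrier[OF U(1)] and Cc = subring_carrier[OF Kbar_subring]
  note TE = subring_closed[OF T(1)] and UE = subring_closed[OF U(1)] and CE = subring_closed[OF Kbar_subring]
  obtain t c where tc: "t \<in> T" "c \<in> Kbar" "x = t \<oplus> c" using join_Kbar_eq_sum[OF T x(1)] .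
  obtain u d where ud: "u \<in> U" "d \<in> Kbar" "x = u \<oplus> d" using join_Kbar_eq_sum[OF U x(2)] .
  obtain e where e: "e \<in> T \<inter> Kbar" "\<forall>c\<in>Kbar. e \<otimes> c \<in> T \<inter> Kbar" "(\<one> \<ominus> e) \<otimes> t \<in> T \<inter> Kbar"
    using comaximal_conductor[OF T tc(1)] .
  obtain f where f: "f \<in> U \<inter> Kbar" "\<forall>c\<in>Kbar. f \<otimes> c \<in> U \<inter> Kbar" "(\<one> \<ominus> f) \<otimes> u \<in> U \<inter> Kbar"
    using comaximal_conductor[OF U ud(1)] .
  have car: "t \<in> carrier R" "c \<in> carrier R" "u \<in> carrier R" "d \<in> carrier R" "e \<in> carrier R" "f \<in> carrier R"
    using tc ud e f Tc Uc Cc by auto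
  then have xc: "x \<in> carrier R" unfolding tc(3) by simp
  define p where "p = e \<otimes> f"
  have "p \<otimes> x = (e \<otimes> f) \<otimes> t \<oplus> e \<otimes> (f \<otimes> c)" unfolding p_def tc(3) using car by algebra
  then have pT: "p \<otimes> x \<in> T" using e(2) f tc TE(4,5) by simp
  have "p \<otimes> x = (f \<otimes> e) \<otimes> u \<oplus> f \<otimes> (e \<otimes> d)" unfolding p_def ud(3) using car by algebra
  then have pU: "p \<otimes> x \<in> U" using e f(2) ud UE(4,5) by simp
  have "(\<one> \<ominus> p) \<otimes> x = (\<one> \<ominus> e) \<otimes> x \<oplus> e \<otimes> ((\<one> \<ominus> f) \<otimes> x)" unfolding p_def using car xc by algebra
  also have "\<dots> = ((\<one> \<ominus> e) \<otimes> t \<oplus> (\<one> \<ominus> e) \<otimes> c) \<oplus> e \<otimes> ((\<one> \<ominus> f) \<otimes> x)"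
    unfolding tc(3) using car by algebra
  also have "(\<one> \<ominus> f) \<otimes> x = (\<one> \<ominus> f) \<otimes> u \<oplus> (\<one> \<ominus> f) \<otimes> d" unfolding ud(3) using car by algebra
  finally have pC: "(\<one> \<ominus> p) \<otimes> x \<in> Kbar" using e f tc ud CE by simp
  have pc: "p \<in> carrier R" unfolding p_def using car by simp
  have "x = p \<otimes> x \<oplus> (\<one> \<ominus> p) \<otimes> x" using pc xc by algebra
  moreover have "p \<otimes> x \<in> compositum R (T \<inter> U) Kbar" "(\<one> \<ominus> p) \<otimes> x \<in> compositum R (T \<inter> U) Kbar"
    using compositum_upper(1)[of "T \<inter> U" Kbar] compositum_upper(2)[of Kbar "T \<inter> U"] pT pU pC by blast+
  ultimately show ?thesis
    using subring_closed(5)[OF compositum_subring[OF subring_inter[OF T(1) U(1)] Kbar_subring]] by metis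
qed

text \<open>
  Over a valuation ring one of \<open>u\<close> and \<open>v\<close> divides the other unless both are integral. This is the global form: a
  partition \<open>1 = p + (1 - p)\<close> such that \<open>u\<close> divides \<open>p v\<close>, and \<open>v\<close> divides \<open>(1 - p) u\<close> up to an element of \<open>Kbar\<close>.
  Where \<open>u\<close> is not integral, the coefficient \<open>b\<close> of its inverse represents \<open>1 / u\<close>, so \<open>b v\<close> represents \<open>v / u\<close>,
  and the invertibility for \<open>b v\<close> decides which of the two divides the other.
\<close>
lemma pruefer_comparison:
  assumes u: "u \<in> carrier R" and v: "v \<in> carrier R"
  obtains p c c0 c1 where "p \<in> Kbar" "c \<in> Kbar" "c0 \<in> Kbar" "c1 \<in> Kbar"
    and "p \<otimes> v = c \<otimes> u" and "(\<one> \<ominus> p) \<otimes> u = c0 \<oplus> c1 \<otimes> v"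
proof -
  note Cc = subring_carrier[OF Kbar_subring] and CE = subring_closed[OF Kbar_subring]
  note pr = pruefer[OF Kbar_subring K_le_Kbar carrier_is_subring subringE(1)[OF Kbar_subring] Kbar_closed]
  obtain a b where ab: "a \<in> Kbar" "b \<in> Kbar" "a \<otimes> u \<in> Kbar" "b \<otimes> u \<in> Kbar" "a \<oplus> b \<otimes> u = \<one>"
    using pr[OF _ u] by metis
  have bc: "a \<in> carrier R" "b \<in> carrier R" using ab Cc by auto
  obtain a' b' where ab': "a' \<in> Kbar" "b' \<in> Kbar" "a' \<otimes> (b \<otimes> v) \<in> Kbar" "b' \<otimes> (b \<otimes> v) \<in> Kbar"
    "a' \<oplus> b' \<otimes> (b \<otimes> v) = \<one>"
    using pr[OF _ m_closed[OF bc(2) v]] by metis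
  have bc': "a' \<in> carrier R" "b' \<in> carrier R" using ab' Cc by auto
  define p where "p = (b \<otimes> u) \<otimes> a'"
  have pC: "p \<in> Kbar" unfolding p_def using ab ab' CE(4) by blast
  then have pc: "p \<in> carrier R" using Cc by blast
  have 1: "p \<otimes> v = (a' \<otimes> (b \<otimes> v)) \<otimes> u" unfolding p_def using bc bc' u v by algebra
  have "(\<one> \<ominus> p) \<otimes> u = ((a \<oplus> (b \<otimes> u) \<otimes> \<one>) \<ominus> p) \<otimes> u" using ab(5) bc u by simp
  also have "\<dots> = ((a \<oplus> (b \<otimes> u) \<otimes> (a' \<oplus> b' \<otimes> (b \<otimes> v))) \<ominus> p) \<otimes> u" unfolding ab'(5) ..
  also have "\<dots> = a \<otimes> u \<oplus> (b' \<otimes> ((b \<otimes> u) \<otimes> (b \<otimes> u))) \<otimes> v" unfolding p_def using bc bc' u v by algebra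
  finally have 2: "(\<one> \<ominus> p) \<otimes> u = a \<otimes> u \<oplus> (b' \<otimes> ((b \<otimes> u) \<otimes> (b \<otimes> u))) \<otimes> v" .
  show ?thesis
    by (rule that[OF pC ab'(3) ab(3) CE(4)[OF ab'(2) CE(4)[OF ab(4) ab(4)]] 1 2])
qed

text \<open>
  The comparison splits \<open>u v\<close> into an element of \<open>U\<close> and one of \<open>V\<close>, so the compositum of \<open>U\<close> and \<open>V\<close> is the
  sum \<open>U + V\<close>. If \<open>x = u + v\<close> lies in \<open>T\<close>, the same partition splits \<open>x\<close> within \<open>T\<close>: \<open>p x\<close> lies in \<open>U\<close> as \<open>p v\<close> does,
  and \<open>(1 - p) x\<close> lies in \<open>V\<close> as \<open>(1 - p) u\<close> does.
\<close>
lemma distributive_above_Kbar: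
  assumes T: "subring T R" "Kbar \<subseteq> T" and U: "subring U R" "Kbar \<subseteq> U" and V: "subring V R" "Kbar \<subseteq> V"
    and x: "x \<in> T" "x \<in> compositum R U V"
  shows "x \<in> compositum R (T \<inter> U) (T \<inter> V)"
proof -
  note Tc = subring_carrier[OF T(1)] and Uc = subring_carrier[OF U(1)] and Vc = subring_carrier[OF V(1)]
    and Cc = subring_carrier[OF Kbar_subring]
  note TE = subring_closed[OF T(1)] and UE = subring_closed[OF U(1)] and VE = subring_closed[OF V(1)]
    and CE = subring_closed[OF Kbar_subring]
  obtain u v where uv: "u \<in> U" "v \<in> V" "x = u \<oplus> v"
  proof (rule compositum_eq_sum[OF U(1) V(1) _ x(2)])
    fix u v assume uv: "u \<in> U" "v \<in> V"
    have c: "u \<in> carrier R" "v \<in> carrier R" using uv Uc Vc by auto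
    obtain p c c0 c1 where p: "p \<in> Kbar" "c \<in> Kbar" "c0 \<in> Kbar" "c1 \<in> Kbar"
      "p \<otimes> v = c \<otimes> u" "(\<one> \<ominus> p) \<otimes> u = c0 \<oplus> c1 \<otimes> v" using pruefer_comparison[OF c] .
    have pc: "p \<in> carrier R" using p Cc by auto
    have "u \<otimes> v = (p \<otimes> v) \<otimes> u \<oplus> ((\<one> \<ominus> p) \<otimes> u) \<otimes> v" using c pc by algebra
    then have "u \<otimes> v = (c \<otimes> u) \<otimes> u \<oplus> (c0 \<oplus> c1 \<otimes> v) \<otimes> v" unfolding p(5,6) .
    moreover have "(c \<otimes> u) \<otimes> u \<in> U" "(c0 \<oplus> c1 \<otimes> v) \<otimes> v \<in> V"
      using p uv U(2) V(2) UE(4) VE(4,5) by (simp_all add: subset_eq)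
    ultimately show "\<exists>u'\<in>U. \<exists>v'\<in>V. u \<otimes> v = u' \<oplus> v'" by blast
  qed blast
  have c: "u \<in> carrier R" "v \<in> carrier R" using uv Uc Vc by auto
  then have xc: "x \<in> carrier R" using uv by simp
  obtain p c c0 c1 where p: "p \<in> Kbar" "c \<in> Kbar" "c0 \<in> Kbar" "c1 \<in> Kbar"
    "p \<otimes> v = c \<otimes> u" "(\<one> \<ominus> p) \<otimes> u = c0 \<oplus> c1 \<otimes> v" using pruefer_comparison[OF c] .
  have pc: "p \<in> carrier R" using p Cc by auto
  have "p \<otimes> x = p \<otimes> u \<oplus> p \<otimes> v" unfolding uv(3) using c pc by algebra
  then have pU: "p \<otimes> x \<in> U" unfolding p(5) using p uv U(2) UE(4,5) by (simp add: subset_eq)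
  have "(\<one> \<ominus> p) \<otimes> x = (\<one> \<ominus> p) \<otimes> u \<oplus> (\<one> \<ominus> p) \<otimes> v" unfolding uv(3) using c pc by algebra
  then have pV: "(\<one> \<ominus> p) \<otimes> x \<in> V"
    unfolding p(6) using p uv V(2) VE(2,4,5,6) by (simp add: subset_eq)
  have pT: "p \<otimes> x \<in> T" "(\<one> \<ominus> p) \<otimes> x \<in> T"
    using p(1) x(1) T(2) TE(2,4,6) by (simp_all add: subset_eq)
  let ?Y = "compositum R (T \<inter> U) (T \<inter> V)"
  have Y: "subring ?Y R"
    by (intro compositum_subring subring_inter T(1) U(1) V(1))
  have "p \<otimes> x \<in> ?Y" using pU pT(1) compositum_upper(1)[of "T \<inter> U" "T \<inter> V"] by blast
  moreover have "(\<one> \<ominus> p) \<otimes> x \<in> ?Y"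
    using pV pT(2) compositum_upper(2)[of "T \<inter> V" "T \<inter> U"] by blast
  ultimately have "p \<otimes> x \<oplus> (\<one> \<ominus> p) \<otimes> x \<in> ?Y" by (rule subring_closed(5)[OF Y])
  moreover have "x = p \<otimes> x \<oplus> (\<one> \<ominus> p) \<otimes> x" using pc xc by algebra
  ultimately show ?thesis by simp
qed

text \<open>
  Since joins with \<open>Kbar\<close> are sums, an element \<open>u\<close> of \<open>U\<close> differs from one of \<open>V\<close> by an element of
  \<open>U \<inter> Kbar\<close>.
\<close>
lemma eq_if_same_meet_join_Kbar:
  assumes V: "subring V R" "K \<subseteq> V" and U: "subring U R" and VU: "V \<subseteq> U"
    and meet: "U \<inter> Kbar \<subseteq> V" and join: "U \<subseteq> compositum R V Kbar"
  shows "U \<subseteq> V"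
proof
  fix u assume u: "u \<in> U"
  then obtain v c where vc: "v \<in> V" "c \<in> Kbar" "u = v \<oplus> c" using join_Kbar_eq_sum[OF V] join by blast
  have "v \<in> carrier R" "c \<in> carrier R"
    using vc subring_carrier[OF V(1)] subring_carrier[OF Kbar_subring] by auto
  then have "c = u \<ominus> v" unfolding vc(3) by algebra
  also have "\<dots> \<in> U" using subring_minus[OF U u] vc(1) VU by blast
  finally have "c \<in> V" using meet vc(2) by blast
  then show "u \<in> V" unfolding vc(3) using subring_closed(5)[OF V(1) vc(1)] by blast
qed

text \<open>
  Both sides of the distributive law are compared through their meets and joins with \<open>Kbar\<close>. The two maps
  commute with the lattice operations, so the meets agree by distributivity below \<open>Kbar\<close> and the joins by
  distributivity above \<open>Kbar\<close>.
\<close>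
lemma distributive_iff_integral_closure:
  "distributive_extension K R \<longleftrightarrow> distributive_extension K (R\<lparr>carrier := Kbar\<rparr>)"
proof
  assume "distributive_extension K R"
  then show "distributive_extension K (R\<lparr>carrier := Kbar\<rparr>)"
    unfolding distributive_extension_subring[OF Kbar_subring] unfolding distributive_extension_def by blast
next
  assume "distributive_extension K (R\<lparr>carrier := Kbar\<rparr>)"
  then have dist: "T \<inter> compositum R U V = compositum R (T \<inter> U) (T \<inter> V)"
    if "subring T R" "K \<subseteq> T" "T \<subseteq> Kbar" "subring U R" "K \<subseteq> U" "U \<subseteq> Kbar" "subring V R" "K \<subseteq> V" "V \<subseteq> Kbar" for T U V
    using that unfolding distributive_extension_subring[OF Kbar_subring] intermediate_rings_def by blast
  have "T \<inter> compositum R U V = compositum R (T \<inter> U) (T \<inter> V)"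
    if T: "subring T R" "K \<subseteq> T" and U: "subring U R" "K \<subseteq> U" and V: "subring V R" "K \<subseteq> V" for T U V
  proof
    let ?X = "T \<inter> compositum R U V" and ?Y = "compositum R (T \<inter> U) (T \<inter> V)"
    let ?c = "\<lambda>B. compositum R B Kbar"
    have sub: "subring (T \<inter> U) R" "subring (T \<inter> V) R" "subring (compositum R U V) R"
      using T U V subring_inter compositum_subring by auto
    have X: "subring ?X R" by (rule subring_inter[OF T(1) sub(3)])
    have Y: "subring ?Y R" by (rule compositum_subring[OF sub(1,2)])
    have KY: "K \<subseteq> ?Y" using T U compositum_upper(1)[of "T \<inter> U" "T \<inter> V"] by blast
    have "?Y \<subseteq> T" by (rule compositum_least[OF T(1)]) auto
    moreover have "?Y \<subseteq> compositum R U V" by (rule compositum_mono[OF U(1) V(1)]) auto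
    ultimately show YX: "?Y \<subseteq> ?X" by blast
    have meet: "?X \<inter> Kbar \<subseteq> ?Y"
    proof
      fix x assume x: "x \<in> ?X \<inter> Kbar"
      then have "x \<in> (T \<inter> Kbar) \<inter> compositum R (U \<inter> Kbar) (V \<inter> Kbar)"
        using meet_Kbar_join[OF U V] by blast
      also have "\<dots> = compositum R ((T \<inter> Kbar) \<inter> (U \<inter> Kbar)) ((T \<inter> Kbar) \<inter> (V \<inter> Kbar))"
        by (rule dist) (use T U V K_le_Kbar Kbar_subring subring_inter in auto)
      also have "\<dots> \<subseteq> ?Y" by (rule compositum_mono[OF sub(1,2)]) auto
      finally show "x \<in> ?Y" .
    qed
    have c: "subring (?c B) R" "B \<subseteq> ?c B" "Kbar \<subseteq> ?c B" if "subring B R" for B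
      using compositum_subring[OF that Kbar_subring] compositum_upper by auto
    have join: "?X \<subseteq> ?c ?Y"
    proof
      fix x assume x: "x \<in> ?X"
      have "compositum R U V \<subseteq> compositum R (?c U) (?c V)"
        by (rule compositum_mono) (use c U V in auto)
      then have "x \<in> compositum R (?c T \<inter> ?c U) (?c T \<inter> ?c V)"
        using x c(2)[OF T(1)] by (intro distributive_above_Kbar) (use c T U V in auto)
      also have "\<dots> \<subseteq> ?c ?Y"
      proof (rule compositum_least[OF c(1)[OF Y]])
        have "?c (T \<inter> U) \<subseteq> ?c ?Y" "?c (T \<inter> V) \<subseteq> ?c ?Y"
          using compositum_mono[OF Y Kbar_subring] compositum_upper by auto
        then show "?c T \<inter> ?c U \<subseteq> ?c ?Y" "?c T \<inter> ?c V \<subseteq> ?c ?Y"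
          using join_Kbar_meet T U V by blast+
      qed
      finally show "x \<in> ?c ?Y" .
    qed
    show "?X \<subseteq> ?Y" by (rule eq_if_same_meet_join_Kbar[OF Y KY X YX meet join])
  qed
  then show "distributive_extension K R"
    unfolding distributive_extension_def intermediate_rings_def by blast
qed

end

theorem theorem3p9:
  fixes S :: "('a, 'b) ring_scheme" and R :: "'a set"
  assumes "cring S"
    and "subring R S" and "R \<subset> carrier S"
    and "FCP R S"
  shows "distributive_extension R S \<longleftrightarrow>
         distributive_extension R (S\<lparr>carrier := integral_closure R S\<rparr>)"
proof -
  interpret FCP_extension S R
    using assms by (simp add: FCP_extension_def FCP_extension_axioms_def)
  have "integral_closure R S = Kbar"
    unfolding Kbar_def by (rule integral_closure_eq[OF assms(2)])
  then show ?thesis using distributive_iff_integral_closure by simp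
qed

end
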